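(* Let $K>0$ and $H\in(0,1)$. Let $B^1$ be a standard Brownian motion and $B^2_H$ a fractional Brownian motion with Hurst parameter $H$, independent of $B^1$. Let $q=q(x,t)$ be the density of the law of $$L_F(t)=t^K B^1(|B^2_H(t)|),\qquad t>0 .$$ Then $q$ is a solution of the fourth-order equation $$t\frac{\partial q}{\partial t}=-K\frac{\partial}{\partial x}\left(xq\right)+\frac{H}{4}\,t^{4K+2H}\,\frac{\partial^4 q}{\partial x^4}+\frac{H\,t^{2K+H}}{\sqrt{2\pi}}\,\frac{d^2}{dx^2}\delta(x),\qquad x\in\mathbb{R},\ t>0,$$ subject to the initial condition $q(x,0)=\delta(x)$.
   Context: A fractional Brownian motion $B_H$ with Hurst parameter $H\in(0,1)$ is a centred Gaussian process with covariance $E\{B_H(s)B_H(t)\}=\frac12\left(|t|^{2H}+|s|^{2H}-|t-s|^{2H}\right)$. The density of $L_F(t)$ is $q(x,t)=2\int_0^\infty \frac{e^{-x^2/(2st^{2K})}}{\sqrt{2\pi s t^{2K}}}\,\frac{e^{-s^2/(2t^{2H})}}{\sqrt{2\pi t^{2H}}}\,ds$. $\delta$ is the Dirac delta at $0$ and $\frac{d^2}{dx^2}\delta=\delta''$ is the distribution with $\langle\phi,\delta''\rangle=\phi''(0)$ for every test function $\phi$; the equation, which contains this term, is understood in the sense of distributions in the variable $x$. The initial condition means that the law $q(x,t)\,dx$ converges weakly to the Dirac mass at $0$ as $t\to0^+$. *)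

theory Defs
  imports "HOL-Probability.Probability"
begin

section \<open>Gaussian processes, Brownian motion, fractional Brownian motion\<close>

text \<open>The library's \<^const>\<open>normal_density\<close> is a density only for positive standard deviation,
  so the degenerate (almost surely constant) case is listed separately.\<close>

definition gaussian_rv :: "'a measure \<Rightarrow> ('a \<Rightarrow> real) \<Rightarrow> bool" where
  "gaussian_rv M X \<longleftrightarrow> X \<in> borel_measurable M \<and>
     (\<exists>\<mu>. (\<exists>\<sigma>>0. distributed M lborel X (\<lambda>x. ennreal (normal_density \<mu> \<sigma> x)))
          \<or> (AE \<omega> in M. X \<omega> = \<mu>))"

definition gaussian_process :: "'a measure \<Rightarrow> real set \<Rightarrow> (real \<Rightarrow> 'a \<Rightarrow> real) \<Rightarrow> bool" where
  "gaussian_process M I X \<longleftrightarrow>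
     (\<forall>F a. finite F \<and> F \<subseteq> I \<longrightarrow> gaussian_rv M (\<lambda>\<omega>. \<Sum>t\<in>F. a t * X t \<omega>))"

text \<open>Both processes are indexed by \<open>[0,\<infinity>)\<close>, the only times that enter
  \<open>t\<^sup>K B\<^sup>1(\<bar>B\<^sup>2(t)\<bar>)\<close>. A two-sided fractional Brownian motion satisfies
  the definition below by restriction.\<close>

definition fractional_brownian_motion ::
    "'a measure \<Rightarrow> real \<Rightarrow> (real \<Rightarrow> 'a \<Rightarrow> real) \<Rightarrow> bool" where
  "fractional_brownian_motion M H X \<longleftrightarrow>
     gaussian_process M {0..} X \<and>
     (\<forall>t\<ge>0. (\<integral>\<omega>. X t \<omega> \<partial>M) = 0) \<and>
     (\<forall>s\<ge>0. \<forall>t\<ge>0. (\<integral>\<omega>. X s \<omega> * X t \<omega> \<partial>M)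
        = 1/2 * (\<bar>t\<bar> powr (2*H) + \<bar>s\<bar> powr (2*H) - \<bar>t - s\<bar> powr (2*H)))"

text \<open>All paths (not just almost all) are continuous; this makes the composed process below
  measurable without completing the probability space.\<close>

definition standard_brownian_motion :: "'a measure \<Rightarrow> (real \<Rightarrow> 'a \<Rightarrow> real) \<Rightarrow> bool" where
  "standard_brownian_motion M B \<longleftrightarrow>
     (\<forall>t\<ge>0. B t \<in> borel_measurable M) \<and>
     (AE \<omega> in M. B 0 \<omega> = 0) \<and>
     (\<forall>(n::nat) (\<tau>::nat \<Rightarrow> real). 0 \<le> \<tau> 0 \<and> (\<forall>i<n. \<tau> i < \<tau> (Suc i)) \<longrightarrow>
        prob_space.indep_vars M (\<lambda>_. borel) (\<lambda>i \<omega>. B (\<tau> (Suc i)) \<omega> - B (\<tau> i) \<omega>) {..<n}) \<and>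
     (\<forall>s t. 0 \<le> s \<and> s < t \<longrightarrow>
        distributed M lborel (\<lambda>\<omega>. B t \<omega> - B s \<omega>)
          (\<lambda>x. ennreal (normal_density 0 (sqrt (t - s)) x))) \<and>
     (\<forall>\<omega>\<in>space M. continuous_on {0..} (\<lambda>t. B t \<omega>))"

text \<open>Independence of processes: as random variables in the product space
  \<open>\<real>\<^bsup>[0,\<infinity>)\<^esup>\<close> with the product \<open>\<sigma>\<close>-algebra.\<close>

definition independent_processes ::
    "'a measure \<Rightarrow> (real \<Rightarrow> 'a \<Rightarrow> real) \<Rightarrow> (real \<Rightarrow> 'a \<Rightarrow> real) \<Rightarrow> bool" where
  "independent_processes M X Y \<longleftrightarrow>
     prob_space.indep_var M
       (PiM {0..} (\<lambda>_. borel)) (\<lambda>\<omega>. \<lambda>t\<in>{0..}. X t \<omega>)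
       (PiM {0..} (\<lambda>_. borel)) (\<lambda>\<omega>. \<lambda>t\<in>{0..}. Y t \<omega>)"

definition L_F ::
    "real \<Rightarrow> (real \<Rightarrow> 'a \<Rightarrow> real) \<Rightarrow> (real \<Rightarrow> 'a \<Rightarrow> real) \<Rightarrow> real \<Rightarrow> 'a \<Rightarrow> real" where
  "L_F K B1 B2 t \<omega> = t powr K * B1 \<bar>B2 t \<omega>\<bar> \<omega>"

definition has_density :: "'a measure \<Rightarrow> ('a \<Rightarrow> real) \<Rightarrow> (real \<Rightarrow> real) \<Rightarrow> bool" where
  "has_density M X f \<longleftrightarrow> (\<forall>x. 0 \<le> f x) \<and> distributed M lborel X (\<lambda>x. ennreal (f x))"

definition LF_density :: "real \<Rightarrow> real \<Rightarrow> real \<Rightarrow> real \<Rightarrow> real" where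
  "LF_density K H x t =
     2 * (LINT s:{0<..}|lborel.
        exp (- x\<^sup>2 / (2 * s * t powr (2*K))) / sqrt (2 * pi * s * t powr (2*K)) *
        (exp (- s\<^sup>2 / (2 * t powr (2*H))) / sqrt (2 * pi * t powr (2*H))))"

section \<open>Distributions on the real line\<close>

definition test_function :: "(real \<Rightarrow> real) \<Rightarrow> bool" where
  "test_function \<phi> \<longleftrightarrow>
     (\<forall>n x. ((deriv ^^ n) \<phi>) differentiable (at x)) \<and> compact (closure {x. \<phi> x \<noteq> 0})"

text \<open>Distributions are functionals that are only ever evaluated at, and compared on,
  test functions.\<close>

type_synonym dist_functional = "(real \<Rightarrow> real) \<Rightarrow> real"

definition locally_integrable :: "(real \<Rightarrow> real) \<Rightarrow> bool" where
  "locally_integrable f \<longleftrightarrow> (\<forall>C. compact C \<longrightarrow> set_integrable lborel C f)"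

definition dist_of :: "(real \<Rightarrow> real) \<Rightarrow> dist_functional" where
  "dist_of f \<phi> = (\<integral>x. f x * \<phi> x \<partial>lborel)"

definition dirac_delta :: dist_functional where
  "dirac_delta \<phi> = \<phi> 0"

definition dist_deriv :: "dist_functional \<Rightarrow> dist_functional" where
  "dist_deriv T \<phi> = - T (deriv \<phi>)"

lemma dist_deriv_2_dirac_delta: "(dist_deriv ^^ 2) dirac_delta \<phi> = (deriv ^^ 2) \<phi> 0"
  by (simp add: dist_deriv_def dirac_delta_def numeral_2_eq_2)

text \<open>Derivative with respect to the parameter \<open>t\<close> of a family of distributions in \<open>x\<close>,
  in the (weak-*) topology of the space of distributions.\<close>

definition has_dist_time_derivative ::
    "(real \<Rightarrow> dist_functional) \<Rightarrow> dist_functional \<Rightarrow> real \<Rightarrow> bool" where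
  "has_dist_time_derivative u D t \<longleftrightarrow>
     (\<forall>\<phi>. test_function \<phi> \<longrightarrow> ((\<lambda>s. u s \<phi>) has_real_derivative D \<phi>) (at t))"

text \<open>The equation
  \<open>t \<partial>\<^sub>t q = - K \<partial>\<^sub>x (x q) + (H/4) t\<^bsup>4K+2H\<^esup> \<partial>\<^sub>x\<^sup>4 q + H t\<^bsup>2K+H\<^esup> / \<surd>(2\<pi>) \<delta>''\<close>
  for \<open>t > 0\<close>, with every term read as a distribution in \<open>x\<close>.\<close>

definition solves_LF_equation :: "real \<Rightarrow> real \<Rightarrow> (real \<Rightarrow> real \<Rightarrow> real) \<Rightarrow> bool" where
  "solves_LF_equation K H q \<longleftrightarrow>
     (\<forall>t>0. locally_integrable (\<lambda>x. q x t) \<and>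
        (\<exists>q\<^sub>t. has_dist_time_derivative (\<lambda>s. dist_of (\<lambda>x. q x s)) q\<^sub>t t \<and>
          (\<forall>\<phi>. test_function \<phi> \<longrightarrow>
             t * q\<^sub>t \<phi> =
               - K * dist_deriv (dist_of (\<lambda>x. x * q x t)) \<phi>
               + H / 4 * t powr (4*K + 2*H) * (dist_deriv ^^ 4) (dist_of (\<lambda>x. q x t)) \<phi>
               + H * t powr (2*K + H) / sqrt (2 * pi) * (dist_deriv ^^ 2) dirac_delta \<phi>)))"

text \<open>Weak convergence of \<open>q(x,t) dx\<close> to the Dirac mass at \<open>0\<close> as \<open>t \<rightarrow> 0+\<close>. The library's
  \<^const>\<open>weak_conv_m\<close> is about sequences of measures, hence the quantification over all
  sequences of times tending to \<open>0\<close> from the right.\<close>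

definition initial_dirac :: "(real \<Rightarrow> real \<Rightarrow> real) \<Rightarrow> bool" where
  "initial_dirac q \<longleftrightarrow>
     (\<forall>\<tau>::nat \<Rightarrow> real. filterlim \<tau> (at_right 0) sequentially \<longrightarrow>
        weak_conv_m (\<lambda>n. density lborel (\<lambda>x. ennreal (q x (\<tau> n)))) (return borel 0))"

end

theory Submission
  imports Defs
begin

text \<open>By independence, path continuity of \<open>B\<^sup>1\<close> and Gaussian scaling, \<open>L\<^sub>F(t)\<close> has the law of
  \<open>c(t) V\<close> with \<open>c(t) = t\<^bsup>K+H/2\<^esup>\<close> and \<open>V = \<surd>\<bar>Z\<bar> W\<close> for independent standard normal \<open>Z, W\<close>.
  Hence \<open>\<langle>\<phi>, q(\<cdot>,t)\<rangle> = E \<phi>(c(t) V)\<close>, and differentiating in \<open>t\<close> turns the equation into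
  \<open>E[c V \<phi>'(c V)] = c\<^sup>2 (2/\<surd>(2\<pi>)) \<phi>''(0) + (c\<^sup>4/2) E \<phi>''''(c V)\<close>. This identity follows by integrating
  by parts twice: first in \<open>W\<close>, which produces a factor \<open>\<bar>Z\<bar>\<close>, and then in \<open>s = \<bar>Z\<bar>\<close> against the
  half-normal density \<open>f\<close>, for which \<open>s f = - f'\<close>. The heat equation evaluates the \<open>s\<close>-derivative of
  \<open>E \<phi>''(c \<surd>s W)\<close>, and the boundary term at \<open>s = 0\<close> is the source \<open>\<delta>''\<close>.\<close>

section \<open>A continuous process at an independent random time\<close>

lemma (in prob_space) indep_var_vimage_algebra_distr:
  assumes indep: "indep_var S X T Y" and f[measurable]: "f \<in> measurable T U"
  defines "N \<equiv> vimage_algebra (space M) X S"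
  shows "distr M N (\<lambda>\<omega>. \<omega>) \<Otimes>\<^sub>M distr M U (\<lambda>\<omega>. f (Y \<omega>)) = distr M (N \<Otimes>\<^sub>M U) (\<lambda>\<omega>. (\<omega>, f (Y \<omega>)))"
proof -
  have X[measurable]: "X \<in> measurable M S" and Y[measurable]: "Y \<in> measurable M T"
    using indep_var_rv1[OF indep] indep_var_rv2[OF indep] .
  have id[measurable]: "(\<lambda>\<omega>. \<omega>) \<in> measurable M N"
    unfolding N_def using X by (auto intro!: measurable_vimage_algebra2)
  interpret P: prob_space "distr M N (\<lambda>\<omega>. \<omega>)" by (rule prob_space_distr) simp
  interpret Q: prob_space "distr M U (\<lambda>\<omega>. f (Y \<omega>))" by (rule prob_space_distr) measurable
  show ?thesis
  proof (rule pair_measure_eqI)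
    fix A B assume "A \<in> sets (distr M N (\<lambda>\<omega>. \<omega>))" and "B \<in> sets (distr M U (\<lambda>\<omega>. f (Y \<omega>)))"
    then have A[measurable]: "A \<in> sets N" and B[measurable]: "B \<in> sets U" by auto
    have "X \<in> space M \<rightarrow> space S" using measurable_space[OF X] by auto
    with A obtain A' where A': "A' \<in> sets S" "A = X -` A' \<inter> space M"
      unfolding N_def by (auto simp: sets_vimage_algebra2)
    define B' where "B' = f -` B \<inter> space T"
    have B': "B' \<in> sets T" unfolding B'_def by measurable
    have fB: "(\<lambda>\<omega>. f (Y \<omega>)) -` B \<inter> space M = Y -` B' \<inter> space M"
      unfolding B'_def using measurable_space[OF Y] by auto
    have "emeasure (distr M (N \<Otimes>\<^sub>M U) (\<lambda>\<omega>. (\<omega>, f (Y \<omega>)))) (A \<times> B)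
        = emeasure M ((\<lambda>\<omega>. (X \<omega>, Y \<omega>)) -` (A' \<times> B') \<inter> space M)"
      using measurable_space[OF Y]
      by (subst emeasure_distr[OF _ pair_measureI[OF A B]])
        (auto simp: A'(2) B'_def intro!: arg_cong[where f="emeasure M"])
    also have "\<dots> = emeasure M (X -` A' \<inter> space M) * emeasure M (Y -` B' \<inter> space M)"
      using indep_varD[OF indep A'(1) B']
      by (simp add: emeasure_eq_measure measure_nonneg ennreal_mult)
    also have "\<dots> = emeasure (distr M N (\<lambda>\<omega>. \<omega>)) A * emeasure (distr M U (\<lambda>\<omega>. f (Y \<omega>))) B"
      using emeasure_distr[OF id A] emeasure_distr[of "\<lambda>\<omega>. f (Y \<omega>)" M U B]
      by (simp add: fB) (simp add: A'(2) Int_def conj_ac)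
    finally show "emeasure (distr M N (\<lambda>\<omega>. \<omega>)) A * emeasure (distr M U (\<lambda>\<omega>. f (Y \<omega>))) B
        = emeasure (distr M (N \<Otimes>\<^sub>M U) (\<lambda>\<omega>. (\<omega>, f (Y \<omega>)))) (A \<times> B)" ..
  qed (auto intro: P.sigma_finite_measure_axioms Q.sigma_finite_measure_axioms)
qed

text \<open>Rounding down to a mesh of width \<open>1 / Suc n\<close> moves a point by at most that
  width. The grid times are nonnegative, so a process indexed by \<open>{0..}\<close> is only
  evaluated inside its index set.\<close>

lemma floor_grid_tendsto:
  fixes y :: real
  assumes "0 \<le> y"
  shows "(\<lambda>n. real (nat \<lfloor>y * real (Suc n)\<rfloor>) / real (Suc n)) \<longlonglongrightarrow> y"
proof (rule tendsto_sandwich[OF _ _ _ tendsto_const])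
  show "(\<lambda>n. y - 1 / real (Suc n)) \<longlonglongrightarrow> y"
    using LIMSEQ_Suc[OF lim_1_over_n] tendsto_diff[OF tendsto_const[of y]] by fastforce
  show "\<forall>\<^sub>F n in sequentially. y - 1 / real (Suc n) \<le> real (nat \<lfloor>y * real (Suc n)\<rfloor>) / real (Suc n)"
  proof (intro always_eventually allI)
    fix n
    have "y * real (Suc n) - 1 \<le> real (nat \<lfloor>y * real (Suc n)\<rfloor>)"
      using assms by linarith
    then have "(y * real (Suc n) - 1) / real (Suc n) \<le> real (nat \<lfloor>y * real (Suc n)\<rfloor>) / real (Suc n)"
      by (rule divide_right_mono) simp
    then show "y - 1 / real (Suc n) \<le> real (nat \<lfloor>y * real (Suc n)\<rfloor>) / real (Suc n)"
      by (simp add: diff_divide_distrib)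
  qed
  show "\<forall>\<^sub>F n in sequentially. real (nat \<lfloor>y * real (Suc n)\<rfloor>) / real (Suc n) \<le> y"
  proof (intro always_eventually allI)
    fix n
    have "0 \<le> y * real (Suc n)" using assms by simp
    then have "real (nat \<lfloor>y * real (Suc n)\<rfloor>) \<le> y * real (Suc n)"
      by linarith
    then show "real (nat \<lfloor>y * real (Suc n)\<rfloor>) / real (Suc n) \<le> y"
      by (simp add: divide_le_eq)
  qed
qed

text \<open>Measurability with respect to the \<open>\<sigma>\<close>-algebra generated by \<open>X\<close> itself, not just that of the
  ambient space, is what makes independence applicable.\<close>

lemma measurable_continuous_process:
  fixes X :: "real \<Rightarrow> 'a \<Rightarrow> real" and \<Omega> :: "'a set"
  defines "N \<equiv> vimage_algebra \<Omega> (\<lambda>\<omega>. \<lambda>t\<in>{0..}. X t \<omega>) (PiM {0..} (\<lambda>_. borel))"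
  assumes cont: "\<And>\<omega>. \<omega> \<in> \<Omega> \<Longrightarrow> continuous_on {0..} (\<lambda>t. X t \<omega>)"
  shows "(\<lambda>(y, \<omega>). X \<bar>y\<bar> \<omega>) \<in> borel_measurable (borel \<Otimes>\<^sub>M N)"
proof (rule borel_measurable_LIMSEQ_real)
  define grid :: "nat \<Rightarrow> real \<Rightarrow> nat" where "grid n y = nat \<lfloor>\<bar>y\<bar> * real (Suc n)\<rfloor>" for n y
  have spN: "space N = \<Omega>" by (simp add: N_def)
  have X[measurable]: "X t \<in> borel_measurable N" if "0 \<le> t" for t
  proof -
    have "(\<lambda>\<omega>. \<lambda>t\<in>{0..}. X t \<omega>) \<in> measurable N (PiM {0..} (\<lambda>_. borel))"
      unfolding N_def by (rule measurable_vimage_algebra1) (auto simp: space_PiM)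
    from measurable_compose[OF this measurable_component_singleton[of t]]
    show ?thesis using that by simp
  qed
  show "(\<lambda>p. X (real (grid n (fst p)) / real (Suc n)) (snd p)) \<in> borel_measurable (borel \<Otimes>\<^sub>M N)" for n
  \<comment> \<open>For fixed \<open>n\<close> the rounded time takes countably many values, so
    joint measurability reduces to measurability at each fixed grid time. Path continuity then
    passes it to the limit in \<open>n\<close>.\<close>
  proof (rule measurable_compose_countable[where f="\<lambda>k p. X (real k / real (Suc n)) (snd p)"])
    show "(\<lambda>p. X (real k / real (Suc n)) (snd p)) \<in> borel_measurable (borel \<Otimes>\<^sub>M N)" for k
      using X[of "real k / real (Suc n)"] by simp
    show "(\<lambda>p. grid n (fst p)) \<in> measurable (borel \<Otimes>\<^sub>M N) (count_space UNIV)"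
      unfolding grid_def by measurable
  qed
  fix p :: "real \<times> 'a" assume "p \<in> space (borel \<Otimes>\<^sub>M N)"
  then have "continuous_on {0..} (\<lambda>t. X t (snd p))"
    by (auto simp: space_pair_measure spN cont)
  then have "(\<lambda>n. X (real (grid n (fst p)) / real (Suc n)) (snd p)) \<longlonglongrightarrow> X \<bar>fst p\<bar> (snd p)"
    by (rule continuous_on_tendsto_compose)
      (use floor_grid_tendsto[of "\<bar>fst p\<bar>"] in \<open>simp_all add: grid_def\<close>)
  then show "(\<lambda>n. X (real (grid n (fst p)) / real (Suc n)) (snd p)) \<longlonglongrightarrow> (case p of (y, \<omega>) \<Rightarrow> X \<bar>y\<bar> \<omega>)"
    by (simp add: case_prod_beta)
qed

text \<open>The random time and the path of \<open>X\<close> have a product joint law, so Tonelli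
  freezes the time at a deterministic value \<open>y\<close> and integrates over the path first. The
  absolute value keeps the time in the index set \<open>{0..}\<close>.\<close>

lemma (in prob_space)
  fixes X :: "real \<Rightarrow> 'a \<Rightarrow> real" and Z :: "'a \<Rightarrow> real \<Rightarrow> real"
  assumes indep: "indep_var (PiM {0..} (\<lambda>_. borel)) (\<lambda>\<omega>. \<lambda>t\<in>{0..}. X t \<omega>) T Z"
    and f: "f \<in> borel_measurable T"
    and cont: "\<And>\<omega>. \<omega> \<in> space M \<Longrightarrow> continuous_on {0..} (\<lambda>t. X t \<omega>)"
  shows random_time_measurable: "(\<lambda>\<omega>. X \<bar>f (Z \<omega>)\<bar> \<omega>) \<in> borel_measurable M"
    and nn_integral_random_time: "g \<in> borel_measurable borel \<Longrightarrow>
      (\<integral>\<^sup>+\<omega>. g (X \<bar>f (Z \<omega>)\<bar> \<omega>) \<partial>M)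
        = (\<integral>\<^sup>+y. (\<integral>\<^sup>+\<omega>. g (X \<bar>y\<bar> \<omega>) \<partial>M) \<partial>distr M borel (\<lambda>\<omega>. f (Z \<omega>)))"
proof -
  define N where "N = vimage_algebra (space M) (\<lambda>\<omega>. \<lambda>t\<in>{0..}. X t \<omega>) (PiM {0..} (\<lambda>_. borel))"
  define Y where "Y \<omega> = f (Z \<omega>)" for \<omega>
  have F[measurable]: "(\<lambda>(y, \<omega>). X \<bar>y\<bar> \<omega>) \<in> borel_measurable (borel \<Otimes>\<^sub>M N)"
    unfolding N_def by (rule measurable_continuous_process) (rule cont)
  have [measurable]: "(\<lambda>\<omega>. \<omega>) \<in> measurable M N"
    unfolding N_def using indep_var_rv1[OF indep] by (auto intro!: measurable_vimage_algebra2)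
  have [measurable]: "Y \<in> borel_measurable M"
    unfolding Y_def using measurable_compose[OF indep_var_rv2[OF indep] f] .
  have "(\<lambda>\<omega>. case (Y \<omega>, \<omega>) of (y, \<omega>) \<Rightarrow> X \<bar>y\<bar> \<omega>) \<in> borel_measurable M"
    by (rule measurable_compose[OF _ F]) measurable
  then show "(\<lambda>\<omega>. X \<bar>f (Z \<omega>)\<bar> \<omega>) \<in> borel_measurable M" by (simp add: Y_def)
  assume [measurable]: "g \<in> borel_measurable borel"
  have joint: "distr M N (\<lambda>\<omega>. \<omega>) \<Otimes>\<^sub>M distr M borel Y = distr M (N \<Otimes>\<^sub>M borel) (\<lambda>\<omega>. (\<omega>, Y \<omega>))"
    using indep_var_vimage_algebra_distr[OF indep f] by (simp add: N_def Y_def[abs_def])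
  interpret P: prob_space "distr M N (\<lambda>\<omega>. \<omega>)" by (rule prob_space_distr) simp
  interpret Q: prob_space "distr M borel Y" by (rule prob_space_distr) simp
  interpret PQ: pair_sigma_finite "distr M N (\<lambda>\<omega>. \<omega>)" "distr M borel Y" ..
  have G[measurable]: "(\<lambda>(\<omega>, y). g (X \<bar>y\<bar> \<omega>)) \<in> borel_measurable (N \<Otimes>\<^sub>M borel)"
    using measurable_compose[OF measurable_compose[OF measurable_pair_swap' F], of g borel]
    by (simp add: case_prod_beta')
  \<comment> \<open>Measurability of the sections with respect to \<open>N\<close> is what allows
    the inner integral to be moved from \<open>distr M N\<close> back to \<open>M\<close>.\<close>
  have sec: "(\<lambda>\<omega>. g (X \<bar>y\<bar> \<omega>)) \<in> borel_measurable N" for y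
    using measurable_compose[OF measurable_Pair2'[of y borel N] G] by simp
  have "(\<integral>\<^sup>+\<omega>. g (X \<bar>Y \<omega>\<bar> \<omega>) \<partial>M)
      = (\<integral>\<^sup>+p. (case p of (\<omega>, y) \<Rightarrow> g (X \<bar>y\<bar> \<omega>)) \<partial>distr M (N \<Otimes>\<^sub>M borel) (\<lambda>\<omega>. (\<omega>, Y \<omega>)))"
    by (subst nn_integral_distr) auto
  also have "\<dots> = (\<integral>\<^sup>+y. (\<integral>\<^sup>+\<omega>. g (X \<bar>y\<bar> \<omega>) \<partial>distr M N (\<lambda>\<omega>. \<omega>)) \<partial>distr M borel Y)"
    unfolding joint[symmetric] by (subst PQ.nn_integral_snd[symmetric]) auto
  also have "\<dots> = (\<integral>\<^sup>+y. (\<integral>\<^sup>+\<omega>. g (X \<bar>y\<bar> \<omega>) \<partial>M) \<partial>distr M borel Y)"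
    by (intro nn_integral_cong nn_integral_distr) (use sec in auto)
  finally show "(\<integral>\<^sup>+\<omega>. g (X \<bar>f (Z \<omega>)\<bar> \<omega>) \<partial>M)
      = (\<integral>\<^sup>+y. (\<integral>\<^sup>+\<omega>. g (X \<bar>y\<bar> \<omega>) \<partial>M) \<partial>distr M borel (\<lambda>\<omega>. f (Z \<omega>)))"
    by (simp add: Y_def[abs_def])
qed

section \<open>Test functions\<close>

text \<open>Off its closed support \<phi> vanishes on an open set, so its derivative vanishes there
  too. The support of the derivative is thus a closed subset of a compact set.\<close>

lemma test_function_deriv:
  assumes "test_function \<phi>"
  shows "test_function (deriv \<phi>)"
proof -
  have sub: "{x. deriv \<phi> x \<noteq> 0} \<subseteq> closure {x. \<phi> x \<noteq> 0}"
  proof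
    fix x assume nz: "x \<in> {x. deriv \<phi> x \<noteq> 0}"
    show "x \<in> closure {x. \<phi> x \<noteq> 0}"
    proof (rule ccontr)
      assume "x \<notin> closure {x. \<phi> x \<noteq> 0}"
      then have x: "x \<in> - closure {x. \<phi> x \<noteq> 0}" by simp
      have z: "0 = \<phi> y" if "y \<in> - closure {x. \<phi> x \<noteq> 0}" for y
        using that subsetD[OF closure_subset, of y "{x. \<phi> x \<noteq> 0}"] by auto
      have "open (- closure {x. \<phi> x \<noteq> 0})" by (intro open_Compl closed_closure)
      then have "(\<phi> has_real_derivative 0) (at x)"
        by (rule has_field_derivative_transform_within_open[OF DERIV_const _ x z])
      then have "deriv \<phi> x = 0" by (rule DERIV_imp_deriv)
      with nz show False by simp
    qed
  qed
  have "((deriv ^^ n) (deriv \<phi>)) differentiable (at x)" for n x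
  proof -
    have "((deriv ^^ Suc n) \<phi>) differentiable (at x)"
      using assms unfolding test_function_def by blast
    then show ?thesis by (simp only: funpow_Suc_right o_def)
  qed
  moreover have "compact (closure {x. \<phi> x \<noteq> 0})"
    using assms by (simp add: test_function_def)
  then have "compact (closure {x. deriv \<phi> x \<noteq> 0})"
    using sub by (metis closed_closure closure_minimal compact_Int_closed inf.absorb_iff2)
  ultimately show ?thesis by (simp add: test_function_def)
qed

lemma test_function_funpow_deriv: "test_function \<phi> \<Longrightarrow> test_function ((deriv ^^ n) \<phi>)"
  by (induction n) (auto intro: test_function_deriv)

lemma test_function_DERIV: "test_function \<phi> \<Longrightarrow> (\<phi> has_real_derivative deriv \<phi> x) (at x)"
proof -
  assume "test_function \<phi>"
  then have "((deriv ^^ 0) \<phi>) differentiable (at x)" unfolding test_function_def by blast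
  then show ?thesis by (simp add: DERIV_deriv_iff_real_differentiable)
qed

lemma test_function_isCont: "test_function \<phi> \<Longrightarrow> isCont \<phi> x"
  using test_function_DERIV DERIV_isCont by blast

lemma test_function_measurable: "test_function \<phi> \<Longrightarrow> \<phi> \<in> borel_measurable borel"
  by (intro borel_measurable_continuous_onI continuous_at_imp_continuous_on ballI test_function_isCont)

lemma test_function_bounded:
  assumes "test_function \<phi>"
  obtains B where "\<And>x. \<bar>\<phi> x\<bar> \<le> B"
proof -
  have "compact (\<phi> ` closure {x. \<phi> x \<noteq> 0})"
    using assms
    by (intro compact_continuous_image continuous_at_imp_continuous_on ballI test_function_isCont)
       (auto simp: test_function_def)
  then have "bounded (\<phi> ` closure {x. \<phi> x \<noteq> 0})" by (rule compact_imp_bounded)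
  then obtain B where B: "\<forall>y \<in> \<phi> ` closure {x. \<phi> x \<noteq> 0}. norm y \<le> B"
    unfolding bounded_iff ..
  have "\<bar>\<phi> x\<bar> \<le> max B 0" for x
  proof (cases "\<phi> x = 0")
    case False
    then have "x \<in> closure {x. \<phi> x \<noteq> 0}" by (intro subsetD[OF closure_subset]) simp
    then have "norm (\<phi> x) \<le> B" by (intro bspec[OF B] imageI)
    then show ?thesis by simp
  qed simp
  then show thesis by (rule that)
qed

section \<open>Differentiation under the expectation with respect to a scale factor\<close>

text \<open>The mean value bound dominates the difference quotients by
  \<open>B' * \<bar>X \<omega>\<bar>\<close>, so dominated convergence applies. It serves twice:
  with a normal variable for the heat flow, where the case \<open>c = 0\<close> is needed for
  continuity at time 0, and with \<open>mix_var\<close> for the time derivative of the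
  density.\<close>

lemma has_real_derivative_expectation_scale:
  fixes h h' X :: "_ \<Rightarrow> real"
  assumes "prob_space M" and X: "integrable M X"
    and h: "\<And>x. (h has_real_derivative h' x) (at x)"
    and bh: "\<And>x. \<bar>h x\<bar> \<le> B" and bh': "\<And>x. \<bar>h' x\<bar> \<le> B'"
    and h'[measurable]: "h' \<in> borel_measurable borel"
  shows "((\<lambda>c. \<integral>\<omega>. h (c * X \<omega>) \<partial>M) has_real_derivative (\<integral>\<omega>. h' (c * X \<omega>) * X \<omega> \<partial>M)) (at c)"
proof -
  interpret prob_space M by fact
  have [measurable]: "X \<in> borel_measurable M" using X by auto
  have [measurable]: "h \<in> borel_measurable borel"
    using h by (intro borel_measurable_continuous_onI continuous_at_imp_continuous_on ballI)
      (blast intro: DERIV_isCont)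
  have int: "integrable M (\<lambda>\<omega>. h (c * X \<omega>))" for c
    by (rule integrable_const_bound[where B=B]) (auto simp: bh)
  have lip: "\<bar>h y - h x\<bar> \<le> B' * \<bar>y - x\<bar>" for x y
    using field_differentiable_bound[of UNIV h h' B' y x] h bh' by auto
  have "((\<lambda>d. \<integral>\<omega>. (h (d * X \<omega>) - h (c * X \<omega>)) / (d - c) \<partial>M) \<longlongrightarrow> (\<integral>\<omega>. h' (c * X \<omega>) * X \<omega> \<partial>M)) (at c)"
    \<comment> \<open>Dominated convergence is a statement about sequences; those considered here
      avoid \<open>c\<close>, so every quotient is a genuine one.\<close>
    unfolding tendsto_at_iff_sequentially
  proof (intro allI impI, unfold o_def)
    fix d :: "nat \<Rightarrow> real"
    assume d: "\<forall>i. d i \<in> UNIV - {c}" "d \<longlonglongrightarrow> c"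
    show "(\<lambda>i. \<integral>\<omega>. (h (d i * X \<omega>) - h (c * X \<omega>)) / (d i - c) \<partial>M) \<longlonglongrightarrow> (\<integral>\<omega>. h' (c * X \<omega>) * X \<omega> \<partial>M)"
    proof (rule integral_dominated_convergence[where w="\<lambda>\<omega>. B' * \<bar>X \<omega>\<bar>"])
      show "integrable M (\<lambda>\<omega>. B' * \<bar>X \<omega>\<bar>)" using X by auto
      show "AE \<omega> in M. (\<lambda>i. (h (d i * X \<omega>) - h (c * X \<omega>)) / (d i - c)) \<longlonglongrightarrow> h' (c * X \<omega>) * X \<omega>"
      proof (rule AE_I2)
        fix \<omega>
        have "((\<lambda>c. h (c * X \<omega>)) has_real_derivative h' (c * X \<omega>) * X \<omega>) (at c)"
          by (rule DERIV_chain'[OF _ h]) (auto intro!: derivative_eq_intros)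
        then have "((\<lambda>d. (h (d * X \<omega>) - h (c * X \<omega>)) / (d - c)) \<longlongrightarrow> h' (c * X \<omega>) * X \<omega>) (at c)"
          by (simp add: has_field_derivative_iff)
        then show "(\<lambda>i. (h (d i * X \<omega>) - h (c * X \<omega>)) / (d i - c)) \<longlonglongrightarrow> h' (c * X \<omega>) * X \<omega>"
          using d unfolding tendsto_at_iff_sequentially o_def by blast
      qed
      show "AE \<omega> in M. norm ((h (d i * X \<omega>) - h (c * X \<omega>)) / (d i - c)) \<le> B' * \<bar>X \<omega>\<bar>" for i
      proof (rule AE_I2)
        fix \<omega>
        have "\<bar>h (d i * X \<omega>) - h (c * X \<omega>)\<bar> \<le> B' * \<bar>X \<omega>\<bar> * \<bar>d i - c\<bar>"
          using lip[of "d i * X \<omega>" "c * X \<omega>"]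
          unfolding left_diff_distrib[symmetric] abs_mult by (simp only: mult_ac)
        then show "norm ((h (d i * X \<omega>) - h (c * X \<omega>)) / (d i - c)) \<le> B' * \<bar>X \<omega>\<bar>"
          using d(1) by (simp add: pos_divide_le_eq)
      qed
    qed auto
  qed
  then show ?thesis
    unfolding has_field_derivative_iff using int by (simp add: diff_divide_distrib)
qed

section \<open>Gaussian integration by parts\<close>

lemma DERIV_std_normal_density:
  "(std_normal_density has_real_derivative - x * std_normal_density x) (at x)"
  unfolding std_normal_density_def
  by (auto intro!: derivative_eq_intros simp: field_simps)

lemma std_normal_density_at_top: "(std_normal_density \<longlongrightarrow> 0) at_top"
proof -
  have "eventually (\<lambda>x::real. x \<le> x\<^sup>2 / 2) at_top"
    using eventually_ge_at_top[of 2] by eventually_elim (simp add: power2_eq_square)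
  from filterlim_at_top_mono[OF filterlim_ident this]
  have "LIM x at_top. - ((x::real)\<^sup>2 / 2) :> at_bot"
    by (simp add: filterlim_uminus_at_bot)
  from filterlim_compose[OF exp_at_bot this]
  show ?thesis unfolding std_normal_density_def[abs_def]
    using tendsto_mult_right_zero[of _ at_top "1 / sqrt (2 * pi)"] by auto
qed

lemma std_normal_density_at_bot: "(std_normal_density \<longlongrightarrow> 0) at_bot"
  using std_normal_density_at_top unfolding filterlim_at_bot_mirror
  by (simp add: std_normal_density_def[abs_def])

lemma bounded_mult_std_normal_density_tendsto_0:
  fixes g :: "real \<Rightarrow> real"
  assumes "\<And>x. \<bar>g x\<bar> \<le> B" and "(std_normal_density \<longlongrightarrow> 0) F"
  shows "((\<lambda>x. g x * std_normal_density x) \<longlongrightarrow> 0) F"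
  by (rule tendsto_0_le[OF assms(2), where K=B])
    (use assms(1) in \<open>auto simp: abs_mult mult.commute[of B] mult.commute[of "\<bar>_\<bar>"]
      intro!: always_eventually mult_left_mono\<close>)

text \<open>Absolute Gaussian moments dominate. The exponents used below are 0 and 1.\<close>

lemma integrable_bounded_mult_std_normal_density:
  fixes g :: "real \<Rightarrow> real"
  assumes "\<And>x. \<bar>g x\<bar> \<le> B" and [measurable]: "g \<in> borel_measurable borel"
  shows "integrable lborel (\<lambda>x. std_normal_density x * (\<bar>x\<bar> ^ k * g x))"
proof (rule Bochner_Integration.integrable_bound)
  show "integrable lborel (\<lambda>x. B * (std_normal_density x * \<bar>x\<bar> ^ k))"
    using integrable_std_normal_moment_abs by (intro integrable_mult_right)
  have "norm (std_normal_density x * (\<bar>x\<bar> ^ k * g x)) \<le> norm (B * (std_normal_density x * \<bar>x\<bar> ^ k))" for x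
  proof -
    have "norm (std_normal_density x * (\<bar>x\<bar> ^ k * g x)) = std_normal_density x * \<bar>x\<bar> ^ k * \<bar>g x\<bar>"
      by (simp add: abs_mult)
    also have "\<dots> \<le> std_normal_density x * \<bar>x\<bar> ^ k * B"
      using assms(1) by (intro mult_left_mono) auto
    also have "\<dots> \<le> norm (B * (std_normal_density x * \<bar>x\<bar> ^ k))"
      by (simp only: mult.commute[of B] real_norm_def abs_ge_self)
    finally show ?thesis .
  qed
  then show "AE x in lborel. norm (std_normal_density x * (\<bar>x\<bar> ^ k * g x)) \<le> norm (B * (std_normal_density x * \<bar>x\<bar> ^ k))"
    by simp
qed simp

lemma integral_std_normal_distribution:
  fixes g :: "real \<Rightarrow> real"
  assumes "g \<in> borel_measurable borel"
  shows "(\<integral>x. g x \<partial>std_normal_distribution) = (\<integral>x. std_normal_density x * g x \<partial>lborel)"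
  using assms by (subst integral_density) auto

text \<open>This is Stein's identity. The derivative of \<open>h\<close> times the density is the
  difference of the two integrands, and that product vanishes at both infinities because
  \<open>h\<close> is bounded.\<close>

lemma gaussian_integration_by_parts:
  fixes h h' :: "real \<Rightarrow> real"
  assumes h: "\<And>x. (h has_real_derivative h' x) (at x)" and h': "\<And>x. isCont h' x"
    and bh: "\<And>x. \<bar>h x\<bar> \<le> B" and bh': "\<And>x. \<bar>h' x\<bar> \<le> B'"
  shows "(\<integral>x. x * h x \<partial>std_normal_distribution) = (\<integral>x. h' x \<partial>std_normal_distribution)"
proof -
  let ?n = std_normal_density
  have ch: "isCont h x" for x using h DERIV_isCont by blast
  have [measurable]: "h \<in> borel_measurable borel" "h' \<in> borel_measurable borel"
    using ch h' by (auto intro!: borel_measurable_continuous_onI continuous_at_imp_continuous_on)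
  have i1: "integrable lborel (\<lambda>x. ?n x * h' x)"
    using integrable_bounded_mult_std_normal_density[of h' B' 0] bh' by simp
  have i2: "integrable lborel (\<lambda>x. ?n x * (x * h x))"
    by (rule Bochner_Integration.integrable_bound[OF integrable_bounded_mult_std_normal_density[of h B 1]])
      (auto simp: bh abs_mult)
  have "(LBINT x=-\<infinity>..\<infinity>. ?n x * h' x - ?n x * (x * h x)) = 0 - 0"
  proof (rule interval_integral_FTC_integrable[where F="\<lambda>x. h x * ?n x"])
    show "((\<lambda>x. h x * ?n x) has_vector_derivative ?n x * h' x - ?n x * (x * h x)) (at x)" for x
      unfolding has_real_derivative_iff_has_vector_derivative[symmetric]
      by (rule DERIV_cong[OF DERIV_mult[OF h DERIV_std_normal_density]]) (simp add: algebra_simps)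
    show "isCont (\<lambda>x. ?n x * h' x - ?n x * (x * h x)) x" for x
      by (intro continuous_intros ch h' DERIV_isCont[OF DERIV_std_normal_density])
    show "set_integrable lborel (einterval (- \<infinity>) \<infinity>) (\<lambda>x. ?n x * h' x - ?n x * (x * h x))"
      using Bochner_Integration.integrable_diff[OF i1 i2] by (simp add: set_integrable_def)
  qed (auto simp: ereal_tendsto_simps
      intro: bounded_mult_std_normal_density_tendsto_0[OF bh] std_normal_density_at_top std_normal_density_at_bot)
  then have "(\<integral>x. ?n x * h' x - ?n x * (x * h x) \<partial>lborel) = 0"
    by (simp add: interval_lebesgue_integral_def set_lebesgue_integral_def)
  then have "(\<integral>x. ?n x * h' x \<partial>lborel) = (\<integral>x. ?n x * (x * h x) \<partial>lborel)"
    using i1 i2 by simp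
  then show ?thesis by (simp add: integral_std_normal_distribution)
qed

section \<open>The heat flow of a test function\<close>

text \<open>The heat flow E h(c sqrt(s) W). The parameter is the variance \<open>s\<close>, not the
  standard deviation, so that differentiation in \<open>s\<close> yields a multiple of the second
  space derivative.\<close>

definition gauss_mean :: "(real \<Rightarrow> real) \<Rightarrow> real \<Rightarrow> real \<Rightarrow> real" where
  "gauss_mean h c s = (\<integral>w. h (c * sqrt s * w) \<partial>std_normal_distribution)"

lemma integrable_std_normal_distribution_id: "integrable std_normal_distribution (\<lambda>w. w)"
  using integrable_std_normal_distribution_moment[of 1] by simp

lemma prob_space_std_normal_distribution: "prob_space std_normal_distribution"
  by (rule prob_space_normal_density) simp

lemma gauss_mean_bounded:
  assumes "\<And>x. \<bar>h x\<bar> \<le> B"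
  shows "\<bar>gauss_mean h c s\<bar> \<le> B"
proof -
  interpret prob_space std_normal_distribution by (rule prob_space_std_normal_distribution)
  have B: "0 \<le> B" using assms[of 0] by linarith
  show ?thesis
  \<comment> \<open>No measurability of \<open>h\<close> is assumed. A non-integrable integrand has
    integral 0 by convention, and \<open>0 \<le> B\<close> covers that case.\<close>
  proof (cases "integrable std_normal_distribution (\<lambda>w. h (c * sqrt s * w))")
    case True
    have "\<bar>gauss_mean h c s\<bar> \<le> (\<integral>w. \<bar>h (c * sqrt s * w)\<bar> \<partial>std_normal_distribution)"
      unfolding gauss_mean_def by (rule integral_abs_bound)
    also have "\<dots> \<le> (\<integral>w. B \<partial>std_normal_distribution)"
      using True assms by (intro integral_mono) auto
    finally show ?thesis using prob_space by simp
  qed (simp add: gauss_mean_def not_integrable_integral_eq B)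
qed

lemma gauss_mean_isCont:
  assumes "test_function h"
  shows "isCont (gauss_mean h c) s"
proof -
  obtain B where B: "\<And>x. \<bar>h x\<bar> \<le> B" by (rule test_function_bounded[OF assms]) blast
  note dh = test_function_deriv[OF assms]
  obtain B' where B': "\<And>x. \<bar>deriv h x\<bar> \<le> B'" by (rule test_function_bounded[OF dh]) blast
  have "isCont (\<lambda>r. \<integral>w. h (r * w) \<partial>std_normal_distribution) r" for r
    by (rule DERIV_isCont[OF has_real_derivative_expectation_scale[OF prob_space_std_normal_distribution
          integrable_std_normal_distribution_id test_function_DERIV[OF assms] B B' test_function_measurable[OF dh]]])
  then have "isCont (\<lambda>s. \<integral>w. h (c * sqrt s * w) \<partial>std_normal_distribution) s"
    by (rule isCont_o2[rotated]) (intro continuous_intros)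
  then show ?thesis unfolding gauss_mean_def[abs_def] .
qed

text \<open>Stein's identity for the dilate of \<open>h\<close>; the chain rule supplies the factor
  \<open>r\<close>. With \<open>r = c * sqrt s\<close> this factor cancels the singular derivative
  of the square root, and for \<open>mix_var\<close> it completes the factor
  \<open>\<bar>z\<bar>\<close>.\<close>

lemma gauss_mean_integration_by_parts:
  assumes "test_function h"
  shows "(\<integral>w. w * h (r * w) \<partial>std_normal_distribution) = r * (\<integral>w. deriv h (r * w) \<partial>std_normal_distribution)"
proof -
  obtain B where B: "\<And>x. \<bar>h x\<bar> \<le> B" by (rule test_function_bounded[OF assms]) blast
  note dh = test_function_deriv[OF assms]
  obtain B' where B': "\<And>x. \<bar>deriv h x\<bar> \<le> B'" by (rule test_function_bounded[OF dh]) blast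
  have "(\<integral>w. w * h (r * w) \<partial>std_normal_distribution) = (\<integral>w. r * deriv h (r * w) \<partial>std_normal_distribution)"
  proof (rule gaussian_integration_by_parts)
    show "((\<lambda>w. h (r * w)) has_real_derivative r * deriv h (r * x)) (at x)" for x
      by (rule DERIV_cong[OF DERIV_chain'[OF _ test_function_DERIV[OF assms]]])
        (auto intro!: derivative_eq_intros)
    show "isCont (\<lambda>w. r * deriv h (r * w)) x" for x
      by (intro continuous_intros isCont_o2[OF _ test_function_isCont[OF dh]])
    show "\<bar>h (r * x)\<bar> \<le> B" for x by (rule B)
    show "\<bar>r * deriv h (r * x)\<bar> \<le> \<bar>r\<bar> * B'" for x using B' by (simp add: abs_mult mult_left_mono)
  qed
  then show ?thesis by simp
qed

text \<open>The heat equation. The chain rule through the square root gives a factor c / (2 sqrt(s))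
  and an extra W in the mean; Stein's identity trades that W for c sqrt(s) and one more derivative,
  and the roots cancel.\<close>

lemma gauss_mean_DERIV:
  assumes "test_function h" and s: "0 < s"
  shows "(gauss_mean h c has_real_derivative c\<^sup>2 / 2 * gauss_mean (deriv (deriv h)) c s) (at s)"
proof -
  obtain B where B: "\<And>x. \<bar>h x\<bar> \<le> B" by (rule test_function_bounded[OF assms(1)]) blast
  note dh = test_function_deriv[OF assms(1)]
  obtain B' where B': "\<And>x. \<bar>deriv h x\<bar> \<le> B'" by (rule test_function_bounded[OF dh]) blast
  let ?r = "c * sqrt s"
  have "((\<lambda>s. \<integral>w. h (c * sqrt s * w) \<partial>std_normal_distribution) has_real_derivative
      (\<integral>w. deriv h (?r * w) * w \<partial>std_normal_distribution) * (c * (inverse (sqrt s) / 2))) (at s)"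
    by (rule DERIV_chain'[OF DERIV_cmult[OF DERIV_real_sqrt[OF s]]
          has_real_derivative_expectation_scale[OF prob_space_std_normal_distribution
          integrable_std_normal_distribution_id test_function_DERIV[OF assms(1)] B B' test_function_measurable[OF dh]]])
  moreover have "(\<integral>w. deriv h (?r * w) * w \<partial>std_normal_distribution) = ?r * gauss_mean (deriv (deriv h)) c s"
    using gauss_mean_integration_by_parts[OF dh, of ?r] by (simp add: gauss_mean_def mult.commute)
  ultimately show ?thesis
    using s unfolding gauss_mean_def[abs_def] by (simp add: field_simps power2_eq_square)
qed

text \<open>On the half line the product of the heat flow and the normal density has derivative m' n
  - s m n, with m' known from the heat equation. Its boundary value at 0 is
  \<open>h 0 / sqrt (2 * pi)\<close>, and evenness in \<open>z\<close> doubles everything. With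
  \<phi>'' for \<open>h\<close> this boundary term becomes the source \<delta>''.\<close>

lemma half_normal_integration_by_parts:
  assumes "test_function h"
  shows "(\<integral>z. \<bar>z\<bar> * gauss_mean h c \<bar>z\<bar> \<partial>std_normal_distribution)
    = 2 / sqrt (2 * pi) * h 0
      + c\<^sup>2 / 2 * (\<integral>z. gauss_mean (deriv (deriv h)) c \<bar>z\<bar> \<partial>std_normal_distribution)"
proof -
  let ?n = std_normal_density
  let ?m = "gauss_mean h c" and ?m2 = "gauss_mean (deriv (deriv h)) c"
  note d2h = test_function_deriv[OF test_function_deriv[OF assms]]
  obtain B where B: "\<And>x. \<bar>h x\<bar> \<le> B" by (rule test_function_bounded[OF assms]) blast
  obtain B2 where B2: "\<And>x. \<bar>deriv (deriv h) x\<bar> \<le> B2" by (rule test_function_bounded[OF d2h]) blast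
  note bm = gauss_mean_bounded[OF B, where c=c] and bm2 = gauss_mean_bounded[OF B2, where c=c]
  note cm = gauss_mean_isCont[OF assms, where c=c] and cm2 = gauss_mean_isCont[OF d2h, where c=c]
  have [measurable]: "?m \<in> borel_measurable borel" "?m2 \<in> borel_measurable borel"
    using cm cm2 by (auto intro!: borel_measurable_continuous_onI continuous_at_imp_continuous_on)
  \<comment> \<open>The even extension to the line of the derivative of \<open>?m s * ?n s\<close>;
    its integrability on the line gives that on the half line.\<close>
  define e where "e z = c\<^sup>2 / 2 * (?n z * ?m2 \<bar>z\<bar>) - ?n z * (\<bar>z\<bar> * ?m \<bar>z\<bar>)" for z
  have i1: "integrable lborel (\<lambda>z. ?n z * ?m2 \<bar>z\<bar>)"
    using integrable_bounded_mult_std_normal_density[of "\<lambda>z. ?m2 \<bar>z\<bar>" B2 0] bm2 by simp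
  have i2: "integrable lborel (\<lambda>z. ?n z * (\<bar>z\<bar> * ?m \<bar>z\<bar>))"
    using integrable_bounded_mult_std_normal_density[of "\<lambda>z. ?m \<bar>z\<bar>" B 1] bm by simp
  have ie: "integrable lborel e" unfolding e_def[abs_def] using i1 i2 by simp
  have m0: "?m 0 = h 0"
    using prob_space.prob_space[OF prob_space_std_normal_distribution] by (simp add: gauss_mean_def)
  have "(LBINT s=ereal 0..\<infinity>. c\<^sup>2 / 2 * (?n s * ?m2 s) - ?n s * (s * ?m s)) = 0 - ?m 0 * ?n 0"
  proof (rule interval_integral_FTC_integrable[where F="\<lambda>s. ?m s * ?n s"])
    show "((\<lambda>s. ?m s * ?n s) has_vector_derivative c\<^sup>2 / 2 * (?n s * ?m2 s) - ?n s * (s * ?m s)) (at s)"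
      if "ereal 0 < ereal s" for s
      unfolding has_real_derivative_iff_has_vector_derivative[symmetric]
      by (rule DERIV_cong[OF DERIV_mult[OF gauss_mean_DERIV[OF assms] DERIV_std_normal_density]])
        (use that in \<open>auto simp: algebra_simps\<close>)
    show "isCont (\<lambda>s. c\<^sup>2 / 2 * (?n s * ?m2 s) - ?n s * (s * ?m s)) s" for s
      by (intro continuous_intros cm cm2 DERIV_isCont[OF DERIV_std_normal_density])
    have "set_integrable lborel {0<..} e"
      using ie unfolding set_integrable_def by (intro integrable_mult_indicator) auto
    then show "set_integrable lborel (einterval (ereal 0) \<infinity>) (\<lambda>s. c\<^sup>2 / 2 * (?n s * ?m2 s) - ?n s * (s * ?m s))"
      unfolding einterval_eq set_integrable_def
      by (rule Bochner_Integration.integrable_cong[THEN iffD1, rotated 2]) (auto simp: e_def indicator_def)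
    \<comment> \<open>The fundamental theorem needs the derivative only on the open half line. At 0
      a one-sided limit suffices, and continuity provides it.\<close>
    have "isCont (\<lambda>s. ?m s * ?n s) 0"
      by (intro continuous_intros cm DERIV_isCont[OF DERIV_std_normal_density])
    then have "((\<lambda>s. ?m s * ?n s) \<longlongrightarrow> ?m 0 * ?n 0) (at_right 0)"
      unfolding isCont_def filterlim_at_split by blast
    then show "(((\<lambda>s. ?m s * ?n s) \<circ> real_of_ereal) \<longlongrightarrow> ?m 0 * ?n 0) (at_right (ereal 0))"
      by (simp only: ereal_tendsto_simps)
    show "(((\<lambda>s. ?m s * ?n s) \<circ> real_of_ereal) \<longlongrightarrow> 0) (at_left \<infinity>)"
      unfolding ereal_tendsto_simps
      by (rule bounded_mult_std_normal_density_tendsto_0[OF bm std_normal_density_at_top])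
  qed simp
  then have "(LBINT s:{0<..}. c\<^sup>2 / 2 * (?n s * ?m2 s) - ?n s * (s * ?m s)) = - (h 0 / sqrt (2 * pi))"
    unfolding interval_lebesgue_integral_def einterval_eq by (simp add: m0 std_normal_density_def)
  \<comment> \<open>The null point 0 is added because the rule for even functions integrates over
    \<open>{0..}\<close>.\<close>
  also have "(LBINT s:{0<..}. c\<^sup>2 / 2 * (?n s * ?m2 s) - ?n s * (s * ?m s)) = (\<integral>s. indicator {0..} s *\<^sub>R e s \<partial>lborel)"
    unfolding set_lebesgue_integral_def
    by (rule integral_cong_AE) (use AE_lborel_singleton[of 0] in \<open>auto simp: e_def indicator_def elim!: eventually_mono\<close>)
  finally have half: "has_bochner_integral lborel (\<lambda>s. indicator {0..} s *\<^sub>R e s) (- (h 0 / sqrt (2 * pi)))"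
    using integrable_mult_indicator[OF _ ie, of "{0..}"] by (auto simp: has_bochner_integral_iff)
  have "has_bochner_integral lborel e (2 *\<^sub>R (- (h 0 / sqrt (2 * pi))))"
    by (rule has_bochner_integral_even_function[OF half]) (simp add: e_def std_normal_density_def)
  then have "(\<integral>z. e z \<partial>lborel) = - (2 / sqrt (2 * pi) * h 0)"
    by (simp add: has_bochner_integral_iff)
  moreover have "(\<integral>z. e z \<partial>lborel) = c\<^sup>2 / 2 * (\<integral>z. ?n z * ?m2 \<bar>z\<bar> \<partial>lborel) - (\<integral>z. ?n z * (\<bar>z\<bar> * ?m \<bar>z\<bar>) \<partial>lborel)"
    unfolding e_def[abs_def] using i1 i2 by simp
  ultimately show ?thesis by (simp add: integral_std_normal_distribution)
qed

section \<open>The normal variance mixture and its integration by parts identity\<close>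

text \<open>The variable V of the overview: the first coordinate is the normalised value Z of the
  fractional motion, the second is W. No time enters, so the whole time dependence of the law sits
  in a deterministic scale factor.\<close>

definition mix_var :: "real \<times> real \<Rightarrow> real" where
  "mix_var p = sqrt \<bar>fst p\<bar> * snd p"

abbreviation std_normal_pair :: "(real \<times> real) measure" where
  "std_normal_pair \<equiv> std_normal_distribution \<Otimes>\<^sub>M std_normal_distribution"

lemma mix_var_measurable[measurable]: "mix_var \<in> borel_measurable (borel \<Otimes>\<^sub>M borel)"
  unfolding mix_var_def[abs_def] by measurable

lemma sets_std_normal_pair[measurable_cong]: "sets std_normal_pair = sets (borel \<Otimes>\<^sub>M borel)"
  by (intro sets_pair_measure_cong) auto

lemma pair_prob_space_std_normal: "pair_prob_space std_normal_distribution std_normal_distribution"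
proof -
  interpret prob_space std_normal_distribution by (rule prob_space_std_normal_distribution)
  show ?thesis by unfold_locales
qed

lemma prob_space_std_normal_pair: "prob_space std_normal_pair"
proof -
  interpret pair_prob_space std_normal_distribution std_normal_distribution
    by (rule pair_prob_space_std_normal)
  show ?thesis by unfold_locales
qed

text \<open>Fubini splits the first absolute moment into a product, and
  \<open>sqrt \<bar>z\<bar> \<le> 1 + \<bar>z\<bar>\<close> bounds the first factor. This moment
  dominates when differentiating in time.\<close>

lemma integrable_mix_var: "integrable std_normal_pair mix_var"
proof -
  interpret pair_prob_space std_normal_distribution std_normal_distribution
    by (rule pair_prob_space_std_normal)
  have sq: "integrable std_normal_distribution (\<lambda>z. sqrt \<bar>z\<bar>)"
  proof (rule Bochner_Integration.integrable_bound)
    show "integrable std_normal_distribution (\<lambda>z. 1 + \<bar>z\<bar>)"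
      using integrable_std_normal_distribution_id M1.prob_space
      by (intro Bochner_Integration.integrable_add integrable_abs) auto
    have "sqrt \<bar>z\<bar> \<le> 1 + \<bar>z\<bar>" for z :: real
      by (rule real_le_lsqrt) (auto simp: power2_eq_square algebra_simps)
    then show "AE z in std_normal_distribution. norm (sqrt \<bar>z\<bar>) \<le> norm (1 + \<bar>z\<bar>)"
      by simp
  qed simp
  show ?thesis
  proof (rule Fubini_integrable)
    have "(\<integral>w. norm (mix_var (z, w)) \<partial>std_normal_distribution)
        = sqrt \<bar>z\<bar> * (\<integral>w. \<bar>w\<bar> \<partial>std_normal_distribution)" for z
      by (simp add: mix_var_def abs_mult)
    then show "integrable std_normal_distribution (\<lambda>z. \<integral>w. norm (mix_var (z, w)) \<partial>std_normal_distribution)"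
      using sq by simp
    show "AE z in std_normal_distribution. integrable std_normal_distribution (\<lambda>w. mix_var (z, w))"
      using integrable_std_normal_distribution_id by (simp add: mix_var_def)
  qed simp
qed

lemma mix_var_identity:
  assumes "test_function \<phi>"
  shows "(\<integral>p. (c * mix_var p) * deriv \<phi> (c * mix_var p) \<partial>std_normal_pair)
    = c\<^sup>2 * (2 / sqrt (2 * pi) * (deriv ^^ 2) \<phi> 0)
      + c ^ 4 / 2 * (\<integral>p. (deriv ^^ 4) \<phi> (c * mix_var p) \<partial>std_normal_pair)"
proof -
  interpret pair_prob_space std_normal_distribution std_normal_distribution
    by (rule pair_prob_space_std_normal)
  have t: "test_function ((deriv ^^ n) \<phi>)" for n by (rule test_function_funpow_deriv[OF assms])
  note t1 = t[of 1, simplified]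
  note [measurable] = test_function_measurable[OF t1] test_function_measurable[OF t]
  obtain B where B: "\<And>x. \<bar>deriv \<phi> x\<bar> \<le> B" by (rule test_function_bounded[OF t1]) blast
  obtain B4 where B4: "\<And>x. \<bar>(deriv ^^ 4) \<phi> x\<bar> \<le> B4" by (rule test_function_bounded[OF t]) blast
  have i1: "integrable std_normal_pair (\<lambda>p. (c * mix_var p) * deriv \<phi> (c * mix_var p))"
  proof (rule Bochner_Integration.integrable_bound)
    show "integrable std_normal_pair (\<lambda>p. B * (c * mix_var p))"
      using integrable_mix_var by (intro integrable_mult_right)
    have "\<bar>x * deriv \<phi> x\<bar> \<le> \<bar>B * x\<bar>" for x
      using mult_right_mono[OF order_trans[OF B abs_ge_self], of "\<bar>x\<bar>" x] by (simp add: abs_mult mult.commute)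
    then show "AE p in std_normal_pair. norm (c * mix_var p * deriv \<phi> (c * mix_var p)) \<le> norm (B * (c * mix_var p))"
      by simp
  qed simp
  have i4: "integrable std_normal_pair (\<lambda>p. (deriv ^^ 4) \<phi> (c * mix_var p))"
    by (rule P.integrable_const_bound[where B=B4]) (auto simp: B4)
  \<comment> \<open>For frozen \<open>z\<close> the scale is
    \<open>?r = c * sqrt \<bar>z\<bar>\<close>. One factor \<open>?r\<close> is present in
    \<open>c * mix_var (z, w)\<close>, Stein's identity adds the other, and their product is
    \<open>c\<^sup>2 * \<bar>z\<bar>\<close>.\<close>
  have inner: "(\<integral>w. (c * mix_var (z, w)) * deriv \<phi> (c * mix_var (z, w)) \<partial>std_normal_distribution)
      = c\<^sup>2 * (\<bar>z\<bar> * gauss_mean (deriv (deriv \<phi>)) c \<bar>z\<bar>)" for z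
  proof -
    let ?r = "c * sqrt \<bar>z\<bar>"
    have "(\<integral>w. (c * mix_var (z, w)) * deriv \<phi> (c * mix_var (z, w)) \<partial>std_normal_distribution)
        = (\<integral>w. ?r * (w * deriv \<phi> (?r * w)) \<partial>std_normal_distribution)"
      by (simp add: mix_var_def mult_ac)
    also have "\<dots> = ?r * (?r * gauss_mean (deriv (deriv \<phi>)) c \<bar>z\<bar>)"
      using gauss_mean_integration_by_parts[OF t1, of ?r] by (simp add: gauss_mean_def)
    also have "\<dots> = c\<^sup>2 * (sqrt \<bar>z\<bar> * sqrt \<bar>z\<bar> * gauss_mean (deriv (deriv \<phi>)) c \<bar>z\<bar>)"
      by (simp only: power2_eq_square mult_ac)
    finally show ?thesis by simp
  qed
  have fst4: "(\<integral>z. gauss_mean ((deriv ^^ 4) \<phi>) c \<bar>z\<bar> \<partial>std_normal_distribution)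
      = (\<integral>p. (deriv ^^ 4) \<phi> (c * mix_var p) \<partial>std_normal_pair)"
    using integral_fst'[OF i4] by (simp add: gauss_mean_def mix_var_def mult_ac)
  have d4: "deriv (deriv (deriv (deriv \<phi>))) = (deriv ^^ 4) \<phi>" and d2: "deriv (deriv \<phi>) = (deriv ^^ 2) \<phi>"
    by (simp_all add: eval_nat_numeral)
  have "(\<integral>p. (c * mix_var p) * deriv \<phi> (c * mix_var p) \<partial>std_normal_pair)
      = c\<^sup>2 * (\<integral>z. \<bar>z\<bar> * gauss_mean (deriv (deriv \<phi>)) c \<bar>z\<bar> \<partial>std_normal_distribution)"
    by (subst integral_fst'[OF i1, symmetric]) (simp add: inner)
  \<comment> \<open>The half-normal identity is applied to the second derivative of \<phi>, so its
    boundary term is \<phi>''(0) and its remaining integral carries the fourth derivative.\<close>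
  also have "\<dots> = c\<^sup>2 * (2 / sqrt (2 * pi) * (deriv ^^ 2) \<phi> 0
      + c\<^sup>2 / 2 * (\<integral>p. (deriv ^^ 4) \<phi> (c * mix_var p) \<partial>std_normal_pair))"
    by (subst half_normal_integration_by_parts[OF t[of 2, folded d2]]) (unfold d4 fst4, simp only: d2)
  finally show ?thesis by (simp add: distrib_left power2_eq_square power4_eq_xxxx)
qed

section \<open>The law of the composed process\<close>

text \<open>The substitution x = \<sigma> w, whose Jacobian absorbs the normalisation of the
  density.\<close>

lemma nn_integral_normal_density_scale:
  fixes g :: "real \<Rightarrow> ennreal"
  assumes "0 < \<sigma>" and [measurable]: "g \<in> borel_measurable borel"
  shows "(\<integral>\<^sup>+x. ennreal (normal_density 0 \<sigma> x) * g x \<partial>lborel) = (\<integral>\<^sup>+w. g (\<sigma> * w) \<partial>std_normal_distribution)"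
proof -
  have *: "ennreal \<bar>\<sigma>\<bar> * (ennreal (normal_density 0 \<sigma> (0 + \<sigma> * w)) * g (0 + \<sigma> * w))
      = ennreal (std_normal_density w) * g (\<sigma> * w)" for w
  proof -
    have "\<sigma> * normal_density 0 \<sigma> (\<sigma> * w) = std_normal_density w"
      using assms(1) by (simp add: normal_density_def real_sqrt_mult power_mult_distrib)
    then show ?thesis
      using assms(1) by (simp add: mult.assoc[symmetric] ennreal_mult[symmetric])
  qed
  have "(\<integral>\<^sup>+x. ennreal (normal_density 0 \<sigma> x) * g x \<partial>lborel)
      = \<bar>\<sigma>\<bar> * (\<integral>\<^sup>+w. ennreal (normal_density 0 \<sigma> (0 + \<sigma> * w)) * g (0 + \<sigma> * w) \<partial>lborel)"
    using assms(1) by (intro nn_integral_real_affine) auto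
  also have "\<dots> = (\<integral>\<^sup>+w. ennreal (std_normal_density w) * g (\<sigma> * w) \<partial>lborel)"
    by (subst nn_integral_cmult[symmetric]) (simp_all only: *, measurable)
  also have "\<dots> = (\<integral>\<^sup>+w. g (\<sigma> * w) \<partial>std_normal_distribution)"
    by (subst nn_integral_density) auto
  finally show ?thesis .
qed

lemma nn_integral_even_lborel:
  fixes f :: "real \<Rightarrow> ennreal"
  assumes [measurable]: "f \<in> borel_measurable borel" and even: "\<And>x. f (- x) = f x"
  shows "(\<integral>\<^sup>+x. f x \<partial>lborel) = 2 * (\<integral>\<^sup>+x. f x * indicator {0<..} x \<partial>lborel)"
proof -
  have neg: "(\<integral>\<^sup>+x. f x * indicator {..<0} x \<partial>lborel) = (\<integral>\<^sup>+x. f x * indicator {0<..} x \<partial>lborel)"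
    by (subst nn_integral_real_affine[where c="-1" and t=0])
      (auto simp: even indicator_def intro!: nn_integral_cong)
  have "(\<integral>\<^sup>+x. f x \<partial>lborel) = (\<integral>\<^sup>+x. f x * indicator {0<..} x + f x * indicator {..<0} x \<partial>lborel)"
    by (rule nn_integral_cong_AE) (use AE_lborel_singleton[of 0] in \<open>auto simp: indicator_def elim!: eventually_mono\<close>)
  also have "\<dots> = (\<integral>\<^sup>+x. f x * indicator {0<..} x \<partial>lborel) + (\<integral>\<^sup>+x. f x * indicator {0<..} x \<partial>lborel)"
    by (subst nn_integral_add) (auto simp: neg)
  finally show ?thesis by (simp add: mult_2)
qed

text \<open>The centring forces \<open>\<mu> = 0\<close>, and the covariance at equal times forces
  the variance \<open>(t powr H)\<^sup>2\<close>. As this is positive, the degenerate Gaussian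
  alternative is excluded.\<close>

lemma fractional_brownian_motion_distributed:
  assumes "prob_space M" and B: "fractional_brownian_motion M H X" and t: "0 < t"
  shows "distributed M lborel (X t) (\<lambda>x. ennreal (normal_density 0 (t powr H) x))"
proof -
  interpret prob_space M by fact
  have g: "gaussian_process M {0..} X" and mean: "expectation (X t) = 0"
    and cov: "expectation (\<lambda>\<omega>. X t \<omega> * X t \<omega>) = 1/2 * (\<bar>t\<bar> powr (2*H) + \<bar>t\<bar> powr (2*H) - \<bar>t - t\<bar> powr (2*H))"
    using B less_imp_le[OF t] unfolding fractional_brownian_motion_def by blast+
  \<comment> \<open>One-dimensional marginals are the linear combinations over a singleton with
    coefficient 1.\<close>
  have "gaussian_rv M (\<lambda>\<omega>. \<Sum>s\<in>{t}. 1 * X s \<omega>)"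
    using g t unfolding gaussian_process_def by (elim allE[of _ "{t}"] allE[of _ "\<lambda>_. 1"]) auto
  then have rv: "X t \<in> borel_measurable M"
    and cases: "\<exists>\<mu>. (\<exists>\<sigma>>0. distributed M lborel (X t) (\<lambda>x. ennreal (normal_density \<mu> \<sigma> x))) \<or> (AE \<omega> in M. X t \<omega> = \<mu>)"
    by (auto simp: gaussian_rv_def)
  \<comment> \<open>The term \<open>\<bar>t - t\<bar> powr (2*H)\<close> is
    \<open>0 powr (2*H)\<close>, which is 0.\<close>
  have var: "expectation (\<lambda>\<omega>. X t \<omega> * X t \<omega>) = (t powr H)\<^sup>2"
    using cov t by (simp add: power2_eq_square powr_add[symmetric])
  from cases obtain \<mu> where "(\<exists>\<sigma>>0. distributed M lborel (X t) (\<lambda>x. ennreal (normal_density \<mu> \<sigma> x))) \<or> (AE \<omega> in M. X t \<omega> = \<mu>)"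
    by blast
  then show ?thesis
  proof
    assume "\<exists>\<sigma>>0. distributed M lborel (X t) (\<lambda>x. ennreal (normal_density \<mu> \<sigma> x))"
    then obtain \<sigma> where \<sigma>: "\<sigma> > 0" and d: "distributed M lborel (X t) (\<lambda>x. ennreal (normal_density \<mu> \<sigma> x))"
      by blast
    have "\<mu> = 0" using normal_distributed_expectation[OF \<sigma> d] mean by simp
    moreover have "\<sigma>\<^sup>2 = (t powr H)\<^sup>2"
      using normal_distributed_variance[OF \<sigma> d] mean var by (simp add: power2_eq_square)
    then have "\<sigma> = t powr H" using \<sigma> by (simp add: power2_eq_iff_nonneg)
    ultimately show ?thesis using d by simp
  next
    assume ae: "AE \<omega> in M. X t \<omega> = \<mu>"
    then have "expectation (X t) = expectation (\<lambda>_. \<mu>)"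
      using rv by (intro integral_cong_AE) auto
    then have "\<mu> = 0" using mean prob_space by simp
    then have "expectation (\<lambda>\<omega>. X t \<omega> * X t \<omega>) = expectation (\<lambda>_. 0)"
      using rv ae by (intro integral_cong_AE) auto
    then show ?thesis using var t by simp
  qed
qed

lemma standard_brownian_motion_distributed:
  assumes B: "standard_brownian_motion M X" and s: "0 < s"
  shows "distributed M lborel (X s) (\<lambda>x. ennreal (normal_density 0 (sqrt s) x))"
proof -
  have [measurable]: "X 0 \<in> borel_measurable M" "X s \<in> borel_measurable M"
    and ae: "AE \<omega> in M. X 0 \<omega> = 0"
    and d: "distributed M lborel (\<lambda>\<omega>. X s \<omega> - X 0 \<omega>) (\<lambda>x. ennreal (normal_density 0 (sqrt (s - 0)) x))"
    using B s less_imp_le[OF s] order_refl[of "0::real"] unfolding standard_brownian_motion_def by blast+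
  have "distr M lborel (X s) = distr M lborel (\<lambda>\<omega>. X s \<omega> - X 0 \<omega>)"
    by (rule distr_cong_AE) (use ae in auto)
  then show ?thesis using d by (simp add: distributed_def)
qed

locale subordinated_motion = prob_space M for M :: "'a measure" +
  fixes B1 B2 :: "real \<Rightarrow> 'a \<Rightarrow> real" and K H :: real
  assumes brownian: "standard_brownian_motion M B1"
    and fractional: "fractional_brownian_motion M H B2"
    and independent: "independent_processes M B1 B2"
begin

lemma B1_continuous: "\<omega> \<in> space M \<Longrightarrow> continuous_on {0..} (\<lambda>t. B1 t \<omega>)"
  using brownian unfolding standard_brownian_motion_def by blast

text \<open>Independence freezes the random time at \<open>\<bar>y\<bar>\<close>, where t^K B^1 is
  centred normal with standard deviation \<open>t powr K * sqrt \<bar>y\<bar>\<close>; the result is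
  averaged over the normal law of \<open>B2 t\<close>.\<close>

lemma
  assumes t: "0 < t"
  shows L_F_measurable: "L_F K B1 B2 t \<in> borel_measurable M"
    and nn_integral_L_F: "g \<in> borel_measurable borel \<Longrightarrow> (\<integral>\<^sup>+\<omega>. g (L_F K B1 B2 t \<omega>) \<partial>M)
      = (\<integral>\<^sup>+y. ennreal (normal_density 0 (t powr H) y) *
          (\<integral>\<^sup>+x. ennreal (normal_density 0 (t powr K * sqrt \<bar>y\<bar>) x) * g x \<partial>lborel) \<partial>lborel)"
proof -
  let ?T = "PiM {0..} (\<lambda>_. borel) :: (real \<Rightarrow> real) measure"
  have ind: "indep_var ?T (\<lambda>\<omega>. \<lambda>t\<in>{0..}. B1 t \<omega>) ?T (\<lambda>\<omega>. \<lambda>t\<in>{0..}. B2 t \<omega>)"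
    using independent by (simp add: independent_processes_def)
  \<comment> \<open>The random time depends on the path of \<open>B2\<close> only through its
    coordinate at \<open>t\<close>, so this projection is the function \<open>f\<close> of the
    random time lemma.\<close>
  have proj: "(\<lambda>\<omega>. \<omega> t) \<in> borel_measurable ?T"
    by (rule measurable_component_singleton) (use t in simp)
  have eval: "(\<lambda>t\<in>{0..}. B2 t \<omega>) t = B2 t \<omega>" for \<omega> using t by simp
  have m: "(\<lambda>\<omega>. B1 \<bar>B2 t \<omega>\<bar> \<omega>) \<in> borel_measurable M"
    using random_time_measurable[OF ind proj B1_continuous] by (simp only: eval)
  show "L_F K B1 B2 t \<in> borel_measurable M"
    unfolding L_F_def[abs_def] using m by measurable
  assume g[measurable]: "g \<in> borel_measurable borel"
  have B2: "distributed M lborel (B2 t) (\<lambda>x. ennreal (normal_density 0 (t powr H) x))"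
    by (rule fractional_brownian_motion_distributed[OF prob_space_axioms fractional t])
  have B1: "(\<integral>\<^sup>+\<omega>. g (t powr K * B1 \<bar>y\<bar> \<omega>) \<partial>M)
      = (\<integral>\<^sup>+x. ennreal (normal_density 0 (t powr K * sqrt \<bar>y\<bar>) x) * g x \<partial>lborel)" if y: "y \<noteq> 0" for y
  proof -
    have "distributed M lborel (B1 \<bar>y\<bar>) (\<lambda>x. ennreal (normal_density 0 (sqrt \<bar>y\<bar>) x))"
      using y by (intro standard_brownian_motion_distributed[OF brownian]) simp
    from normal_density_affine[OF this, of "t powr K" 0]
    have "distributed M lborel (\<lambda>\<omega>. t powr K * B1 \<bar>y\<bar> \<omega>) (\<lambda>x. ennreal (normal_density 0 (t powr K * sqrt \<bar>y\<bar>) x))"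
      using t y by simp
    from distributed_nn_integral[OF this, of g] show ?thesis by simp
  qed
  have m2: "(\<lambda>y. \<integral>\<^sup>+x. ennreal (normal_density 0 (t powr K * sqrt \<bar>y\<bar>) x) * g x \<partial>lborel) \<in> borel_measurable borel"
    unfolding normal_density_def by measurable
  \<comment> \<open>The point \<open>y = 0\<close>, where \<open>normal_density\<close> has standard deviation \<open>0\<close>, is negligible.\<close>
  have AEy: "AE y in distr M borel (B2 t). y \<noteq> 0"
  proof -
    have eq: "distr M borel (B2 t) = density lborel (\<lambda>x. ennreal (normal_density 0 (t powr H) x))"
      using B2 unfolding distributed_def by (metis distr_cong sets_lborel)
    show ?thesis
      unfolding eq using AE_lborel_singleton[of "0::real"]
      by (subst AE_density) (auto elim!: eventually_mono)
  qed
  have "(\<integral>\<^sup>+\<omega>. g (L_F K B1 B2 t \<omega>) \<partial>M)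
      = (\<integral>\<^sup>+y. (\<integral>\<^sup>+\<omega>. g (t powr K * B1 \<bar>y\<bar> \<omega>) \<partial>M) \<partial>distr M borel (B2 t))"
    using nn_integral_random_time[OF ind proj B1_continuous, of "\<lambda>x. g (t powr K * x)"]
    by (simp add: eval L_F_def del: restrict_apply)
  also have "\<dots> = (\<integral>\<^sup>+y. (\<integral>\<^sup>+x. ennreal (normal_density 0 (t powr K * sqrt \<bar>y\<bar>) x) * g x \<partial>lborel) \<partial>distr M borel (B2 t))"
    by (rule nn_integral_cong_AE) (use AEy in \<open>auto simp: B1 elim!: eventually_mono\<close>)
  also have "\<dots> = (\<integral>\<^sup>+\<omega>. (\<integral>\<^sup>+x. ennreal (normal_density 0 (t powr K * sqrt \<bar>B2 t \<omega>\<bar>) x) * g x \<partial>lborel) \<partial>M)"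
    using B2 m2 by (subst nn_integral_distr) (auto simp: distributed_def)
  also have "\<dots> = (\<integral>\<^sup>+y. ennreal (normal_density 0 (t powr H) y) *
          (\<integral>\<^sup>+x. ennreal (normal_density 0 (t powr K * sqrt \<bar>y\<bar>) x) * g x \<partial>lborel) \<partial>lborel)"
    using distributed_nn_integral[OF B2, of "\<lambda>y. \<integral>\<^sup>+x. ennreal (normal_density 0 (t powr K * sqrt \<bar>y\<bar>) x) * g x \<partial>lborel"] m2
    by simp
  finally show "(\<integral>\<^sup>+\<omega>. g (L_F K B1 B2 t \<omega>) \<partial>M) = \<dots>" .
qed

text \<open>Both normal densities are rescaled to standard ones. Substituting t^H z for y under the
  square root contributes t^(H/2), which joins t^K to form the single scale t^(K + H/2).\<close>

lemma nn_integral_L_F_mix_var: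
  assumes t: "0 < t" and g[measurable]: "g \<in> borel_measurable borel"
  shows "(\<integral>\<^sup>+\<omega>. g (L_F K B1 B2 t \<omega>) \<partial>M) = (\<integral>\<^sup>+p. g (t powr (K + H/2) * mix_var p) \<partial>std_normal_pair)"
proof -
  interpret N: prob_space std_normal_distribution by (rule prob_space_std_normal_distribution)
  let ?G = "\<lambda>y. \<integral>\<^sup>+w. g (t powr K * sqrt \<bar>y\<bar> * w) \<partial>std_normal_distribution"
  have [measurable]: "?G \<in> borel_measurable borel" by measurable
  have half: "sqrt (t powr H) = t powr (H/2)" using t by (simp add: powr_half_sqrt[symmetric] powr_powr)
  have "(\<integral>\<^sup>+\<omega>. g (L_F K B1 B2 t \<omega>) \<partial>M) = (\<integral>\<^sup>+y. ennreal (normal_density 0 (t powr H) y) * ?G y \<partial>lborel)"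
    unfolding nn_integral_L_F[OF t g]
  proof (rule nn_integral_cong_AE)
    show "AE y in lborel. ennreal (normal_density 0 (t powr H) y) *
        (\<integral>\<^sup>+x. ennreal (normal_density 0 (t powr K * sqrt \<bar>y\<bar>) x) * g x \<partial>lborel)
        = ennreal (normal_density 0 (t powr H) y) * ?G y"
      using AE_lborel_singleton[of 0]
      by eventually_elim (use t in \<open>simp add: nn_integral_normal_density_scale\<close>)
  qed
  also have "\<dots> = (\<integral>\<^sup>+z. ?G (t powr H * z) \<partial>std_normal_distribution)"
    using t by (intro nn_integral_normal_density_scale) auto
  also have "\<dots> = (\<integral>\<^sup>+z. \<integral>\<^sup>+w. g (t powr (K + H/2) * mix_var (z, w)) \<partial>std_normal_distribution \<partial>std_normal_distribution)"
    using t by (simp add: mix_var_def abs_mult real_sqrt_mult half powr_add mult.assoc)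
  also have "\<dots> = (\<integral>\<^sup>+p. g (t powr (K + H/2) * mix_var p) \<partial>std_normal_pair)"
    by (subst N.nn_integral_fst[symmetric]) auto
  finally show ?thesis .
qed

lemma distr_L_F:
  assumes t: "0 < t"
  shows "distr M borel (L_F K B1 B2 t) = distr std_normal_pair borel (\<lambda>p. t powr (K + H/2) * mix_var p)"
proof (rule measure_eqI)
  fix A assume "A \<in> sets (distr M borel (L_F K B1 B2 t))"
  then have [measurable]: "A \<in> sets borel" by simp
  note [measurable] = L_F_measurable[OF t]
  have "emeasure (distr M borel (L_F K B1 B2 t)) A = (\<integral>\<^sup>+\<omega>. indicator A (L_F K B1 B2 t \<omega>) \<partial>M)"
    by (subst nn_integral_indicator[symmetric], simp) (subst nn_integral_distr, auto)
  also have "\<dots> = (\<integral>\<^sup>+p. indicator A (t powr (K + H/2) * mix_var p) \<partial>std_normal_pair)"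
    by (rule nn_integral_L_F_mix_var[OF t]) simp
  also have "\<dots> = emeasure (distr std_normal_pair borel (\<lambda>p. t powr (K + H/2) * mix_var p)) A"
    by (subst nn_integral_indicator[symmetric], simp) (subst nn_integral_distr, auto)
  finally show "emeasure (distr M borel (L_F K B1 B2 t)) A = \<dots>" .
qed simp

text \<open>\<open>LF_density\<close> is the x-marginal of the joint density of the value and of
  \<open>B2 t\<close>. That density is even in the second variable, so the integral folds onto the
  positive half line; this is the origin of the factor 2.\<close>

lemma LF_density_has_density:
  assumes t: "0 < t"
  shows "has_density M (L_F K B1 B2 t) (\<lambda>x. LF_density K H x t)"
proof -
  define k where "k x y = normal_density 0 (t powr H) y * normal_density 0 (t powr K * sqrt \<bar>y\<bar>) x" for x y
  have k[measurable]: "(\<lambda>(x, y). k x y) \<in> borel_measurable (borel \<Otimes>\<^sub>M borel)"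
    unfolding k_def normal_density_def by measurable
  have k0: "0 \<le> k x y" for x y by (simp add: k_def)
  have LF: "LF_density K H x t = 2 * (\<integral>s. indicator {0<..} s * k x s \<partial>lborel)" for x
    unfolding LF_density_def set_lebesgue_integral_def
  proof (intro arg_cong[where f="\<lambda>z. 2 * z"] Bochner_Integration.integral_cong refl)
    fix s :: real
    have sq: "(t powr a)\<^sup>2 = t powr (2 * a)" for a using t by (simp add: power2_eq_square powr_add[symmetric])
    show "indicator {0<..} s *\<^sub>R (exp (- x\<^sup>2 / (2 * s * t powr (2*K))) / sqrt (2 * pi * s * t powr (2*K)) *
        (exp (- s\<^sup>2 / (2 * t powr (2*H))) / sqrt (2 * pi * t powr (2*H)))) = indicator {0<..} s * k x s"
      by (cases "0 < s") (simp_all add: k_def normal_density_def power_mult_distrib sq mult_ac)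
  qed
  have LF0: "0 \<le> LF_density K H x t" for x
    unfolding LF using k0 by (intro mult_nonneg_nonneg Bochner_Integration.integral_nonneg) auto
  have LFm[measurable]: "(\<lambda>x. LF_density K H x t) \<in> borel_measurable borel"
    unfolding LF by measurable
  \<comment> \<open>The marginal is first taken as an \<open>ennreal\<close> integral, so that
    Tonelli identifies the law before any finiteness is known.\<close>
  define q0 where "q0 x = (\<integral>\<^sup>+y. ennreal (k x y) \<partial>lborel)" for x
  have [measurable]: "q0 \<in> borel_measurable borel" unfolding q0_def[abs_def] by measurable
  have law: "(\<integral>\<^sup>+\<omega>. g (L_F K B1 B2 t \<omega>) \<partial>M) = (\<integral>\<^sup>+x. q0 x * g x \<partial>lborel)"
    if [measurable]: "g \<in> borel_measurable borel" for g
  proof -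
    have [measurable]: "(\<lambda>(y, x). ennreal (normal_density 0 (t powr K * sqrt \<bar>y\<bar>) x) * g x) \<in> borel_measurable (borel \<Otimes>\<^sub>M borel)"
      unfolding normal_density_def by measurable
    have "(\<integral>\<^sup>+\<omega>. g (L_F K B1 B2 t \<omega>) \<partial>M) = (\<integral>\<^sup>+y. \<integral>\<^sup>+x. ennreal (k x y) * g x \<partial>lborel \<partial>lborel)"
      unfolding nn_integral_L_F[OF t that]
      by (subst nn_integral_cmult[symmetric]) (auto simp: k_def ennreal_mult mult.assoc intro!: nn_integral_cong)
    also have "\<dots> = (\<integral>\<^sup>+x. \<integral>\<^sup>+y. ennreal (k x y) * g x \<partial>lborel \<partial>lborel)"
      by (rule lborel_pair.Fubini') measurable
    also have "\<dots> = (\<integral>\<^sup>+x. q0 x * g x \<partial>lborel)"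
      unfolding q0_def by (intro nn_integral_cong nn_integral_multc) measurable
    finally show ?thesis .
  qed
  have "(\<integral>\<^sup>+x. q0 x \<partial>lborel) = 1" using law[of "\<lambda>_. 1"] by (simp add: emeasure_space_1)
  \<comment> \<open>\<open>LF_density\<close> is a Bochner integral, so it agrees with \<open>q0\<close> only where \<open>q0\<close> is finite.\<close>
  then have fin: "AE x in lborel. q0 x \<noteq> \<infinity>"
    by (intro nn_integral_PInf_AE) auto
  have q0: "AE x in lborel. q0 x = ennreal (LF_density K H x t)"
    using fin
  proof eventually_elim
    fix x assume f: "q0 x \<noteq> \<infinity>"
    have [measurable]: "k x \<in> borel_measurable borel" using measurable_compose[OF measurable_Pair1' k, of x] by simp
    have "q0 x = 2 * (\<integral>\<^sup>+y. ennreal (k x y) * indicator {0<..} y \<partial>lborel)"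
      unfolding q0_def by (rule nn_integral_even_lborel) (simp_all add: k_def normal_density_def)
    also have "(\<integral>\<^sup>+y. ennreal (k x y) * indicator {0<..} y \<partial>lborel) = (\<integral>\<^sup>+y. ennreal (indicator {0<..} y * k x y) \<partial>lborel)"
      by (auto intro!: nn_integral_cong simp: indicator_def)
    finally have e: "q0 x = 2 * (\<integral>\<^sup>+y. ennreal (indicator {0<..} y * k x y) \<partial>lborel)" .
    have "(\<integral>\<^sup>+y. ennreal (indicator {0<..} y * k x y) \<partial>lborel) < \<infinity>"
      using f unfolding e by (auto simp: ennreal_mult_eq_top_iff less_top)
    then have "integrable lborel (\<lambda>y. indicator {0<..} y * k x y)"
      by (intro integrableI_nonneg) (auto simp: k0)
    from nn_integral_eq_integral[OF this] show "q0 x = ennreal (LF_density K H x t)"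
      unfolding e LF by (simp add: k0 ennreal_mult' del: ennreal_numeral) (simp add: ennreal_mult')
  qed
  have "distr M lborel (L_F K B1 B2 t) = density lborel (\<lambda>x. ennreal (LF_density K H x t))"
  proof (rule measure_eqI)
    fix A assume "A \<in> sets (distr M lborel (L_F K B1 B2 t))"
    then have [measurable]: "A \<in> sets borel" by simp
    note [measurable] = L_F_measurable[OF t]
    have "emeasure (distr M lborel (L_F K B1 B2 t)) A = (\<integral>\<^sup>+\<omega>. indicator A (L_F K B1 B2 t \<omega>) \<partial>M)"
      by (subst nn_integral_indicator[symmetric], simp) (subst nn_integral_distr, auto)
    also have "\<dots> = (\<integral>\<^sup>+x. q0 x * indicator A x \<partial>lborel)" by (rule law) simp
    also have "\<dots> = (\<integral>\<^sup>+x. ennreal (LF_density K H x t) * indicator A x \<partial>lborel)"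
      by (rule nn_integral_cong_AE) (use q0 in \<open>auto elim!: eventually_mono\<close>)
    also have "\<dots> = emeasure (density lborel (\<lambda>x. ennreal (LF_density K H x t))) A"
      by (subst emeasure_density) auto
    finally show "emeasure (distr M lborel (L_F K B1 B2 t)) A = \<dots>" .
  qed simp
  then show ?thesis
    using LF0 L_F_measurable[OF t] by (auto simp: has_density_def distributed_def)
qed

section \<open>The equation and the initial condition for an arbitrary version of the
  density\<close>

context
  fixes q :: "real \<Rightarrow> real \<Rightarrow> real"
  assumes q: "\<And>t. 0 < t \<Longrightarrow> has_density M (L_F K B1 B2 t) (\<lambda>x. q x t)"
begin

lemma density_eq_distr_mix_var:
  assumes t: "0 < t"
  shows "density lborel (\<lambda>x. ennreal (q x t)) = distr std_normal_pair borel (\<lambda>p. t powr (K + H/2) * mix_var p)"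
proof -
  have "density lborel (\<lambda>x. ennreal (q x t)) = distr M borel (L_F K B1 B2 t)"
    using q[OF t] unfolding has_density_def distributed_def by (metis distr_cong sets_lborel)
  then show ?thesis by (simp add: distr_L_F[OF t])
qed

lemma q_measurable: "0 < t \<Longrightarrow> (\<lambda>x. q x t) \<in> borel_measurable borel"
  using q[of t] distributed_real_measurable[of lborel "\<lambda>x. q x t" M "L_F K B1 B2 t"]
  by (auto simp: has_density_def)

text \<open>Pairing with \<open>q\<close> depends only on the law, so it becomes an expectation over
  a fixed probability space in which \<open>t\<close> enters only through the scale. This permits
  differentiation in \<open>t\<close> without any regularity of \<open>q\<close>.\<close>

lemma integral_q:
  fixes g :: "real \<Rightarrow> real"
  assumes t: "0 < t" and [measurable]: "g \<in> borel_measurable borel"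
  shows "(\<integral>x. q x t * g x \<partial>lborel) = (\<integral>p. g (t powr (K + H/2) * mix_var p) \<partial>std_normal_pair)"
proof -
  note [measurable] = q_measurable[OF t]
  have "(\<integral>x. q x t * g x \<partial>lborel) = (\<integral>x. g x \<partial>density lborel (\<lambda>x. ennreal (q x t)))"
    using q[OF t] by (subst integral_density) (auto simp: has_density_def)
  also have "\<dots> = (\<integral>p. g (t powr (K + H/2) * mix_var p) \<partial>std_normal_pair)"
    unfolding density_eq_distr_mix_var[OF t] by (subst integral_distr) auto
  finally show ?thesis .
qed

lemma locally_integrable_q:
  assumes t: "0 < t"
  shows "locally_integrable (\<lambda>x. q x t)"
proof -
  note [measurable] = q_measurable[OF t]
  have "prob_space (density lborel (\<lambda>x. ennreal (q x t)))"
    unfolding density_eq_distr_mix_var[OF t]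
    by (rule prob_space.prob_space_distr[OF prob_space_std_normal_pair]) simp
  then have "(\<integral>\<^sup>+x. ennreal (q x t) \<partial>lborel) = 1"
    using prob_space.emeasure_space_1 by (fastforce simp: emeasure_density)
  then have "integrable lborel (\<lambda>x. q x t)"
    using q[OF t] by (intro integrableI_nonneg) (auto simp: has_density_def)
  then show ?thesis
    unfolding locally_integrable_def set_integrable_def
    by (intro allI impI integrable_mult_indicator) (simp_all add: borel_compact)
qed

text \<open>By the chain rule, t d/dt of E \<phi>(t^a V) is a times E1 = E[c V \<phi>'(c V)].
  Writing a = K + H/2, the K part is the transport term, and \<open>mix_var_identity\<close> turns
  the H/2 part into the fourth-order term and the source.\<close>

lemma solves_LF_equation_q: "solves_LF_equation K H q"
  unfolding solves_LF_equation_def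
proof (intro allI impI conjI)
  fix t :: real assume t: "0 < t"
  show "locally_integrable (\<lambda>x. q x t)" by (rule locally_integrable_q[OF t])
  define a where "a = K + H/2"
  define D where "D \<phi> = (\<integral>p. deriv \<phi> (t powr a * mix_var p) * mix_var p \<partial>std_normal_pair) * (a * t powr (a - 1))" for \<phi>
  have "has_dist_time_derivative (\<lambda>s. dist_of (\<lambda>x. q x s)) D t"
    unfolding has_dist_time_derivative_def
  proof (intro allI impI)
    fix \<phi> assume \<phi>: "test_function \<phi>"
    note d\<phi> = test_function_deriv[OF \<phi>]
    obtain B where B: "\<And>x. \<bar>\<phi> x\<bar> \<le> B" by (rule test_function_bounded[OF \<phi>]) blast
    obtain B' where B': "\<And>x. \<bar>deriv \<phi> x\<bar> \<le> B'" by (rule test_function_bounded[OF d\<phi>]) blast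
    have pw: "((\<lambda>s. s powr a) has_real_derivative a * t powr (a - 1)) (at t)"
      using t by (rule has_real_derivative_powr)
    have "((\<lambda>s. \<integral>p. \<phi> (s powr a * mix_var p) \<partial>std_normal_pair) has_real_derivative D \<phi>) (at t)"
      unfolding D_def
      by (rule DERIV_chain'[OF pw has_real_derivative_expectation_scale[OF prob_space_std_normal_pair
            integrable_mix_var test_function_DERIV[OF \<phi>] B B' test_function_measurable[OF d\<phi>]]])
    then show "((\<lambda>s. dist_of (\<lambda>x. q x s) \<phi>) has_real_derivative D \<phi>) (at t)"
    \<comment> \<open>The pairing equals the expectation only at positive times; the open half line
      is a neighbourhood of \<open>t\<close>, which suffices for the derivative.\<close>
    proof (rule has_field_derivative_transform_within_open[where S="{0<..}"])
      fix s :: real assume "s \<in> {0<..}"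
      then show "(\<integral>p. \<phi> (s powr a * mix_var p) \<partial>std_normal_pair) = dist_of (\<lambda>x. q x s) \<phi>"
        using test_function_measurable[OF \<phi>] by (simp add: dist_of_def integral_q a_def)
    qed (use t in auto)
  qed
  moreover have "t * D \<phi> = - K * dist_deriv (dist_of (\<lambda>x. x * q x t)) \<phi>
               + H / 4 * t powr (4*K + 2*H) * (dist_deriv ^^ 4) (dist_of (\<lambda>x. q x t)) \<phi>
               + H * t powr (2*K + H) / sqrt (2 * pi) * (dist_deriv ^^ 2) dirac_delta \<phi>"
    if \<phi>: "test_function \<phi>" for \<phi>
  proof -
    define c where "c = t powr a"
    define E1 where "E1 = (\<integral>p. (c * mix_var p) * deriv \<phi> (c * mix_var p) \<partial>std_normal_pair)"
    define E4 where "E4 = (\<integral>p. (deriv ^^ 4) \<phi> (c * mix_var p) \<partial>std_normal_pair)"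
    note m1[measurable] = test_function_measurable[OF test_function_deriv[OF \<phi>]]
    note m4[measurable] = test_function_measurable[OF test_function_funpow_deriv[OF \<phi>, of 4]]
    have c2: "c\<^sup>2 = t powr (2*K + H)"
      using t by (simp add: c_def a_def power2_eq_square powr_add[symmetric] algebra_simps)
    have c4: "c ^ 4 = t powr (4*K + 2*H)"
      using t by (simp add: c_def a_def power4_eq_xxxx powr_add[symmetric] algebra_simps)
    have "t * t powr (a - 1) = c"
      using t by (simp add: c_def powr_diff)
    then have "t * D \<phi> = a * (c * (\<integral>p. deriv \<phi> (c * mix_var p) * mix_var p \<partial>std_normal_pair))"
      unfolding D_def c_def[symmetric] by (simp add: mult_ac)
    also have "c * (\<integral>p. deriv \<phi> (c * mix_var p) * mix_var p \<partial>std_normal_pair) = E1"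
      unfolding E1_def by (subst integral_mult_right_zero[symmetric]) (simp add: mult_ac)
    finally have tD: "t * D \<phi> = K * E1 + H / 2 * E1" by (simp add: a_def distrib_right)
    have d1: "dist_deriv (dist_of (\<lambda>x. x * q x t)) \<phi> = - E1"
      using integral_q[OF t, of "\<lambda>x. x * deriv \<phi> x"]
      by (simp add: dist_deriv_def dist_of_def E1_def c_def a_def mult_ac)
    \<comment> \<open>The four sign changes from the distributional derivatives cancel.\<close>
    have d4: "(dist_deriv ^^ 4) (dist_of (\<lambda>x. q x t)) \<phi> = E4"
      using integral_q[OF t m4] unfolding E4_def c_def a_def
      by (simp add: dist_deriv_def dist_of_def eval_nat_numeral)
    \<comment> \<open>Multiplying the identity by H/2 turns its coefficients 1/2 and 2/sqrt(2 pi)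
      into H/4 and H/sqrt(2 pi).\<close>
    have "H / 2 * E1 = H / 4 * c ^ 4 * E4 + H * c\<^sup>2 / sqrt (2 * pi) * (deriv ^^ 2) \<phi> 0"
      unfolding E1_def E4_def mix_var_identity[OF \<phi>] by (simp add: field_simps)
    then show ?thesis
      unfolding tD d1 d4 dist_deriv_2_dirac_delta c2[symmetric] c4[symmetric] by simp
  qed
  ultimately show "\<exists>q\<^sub>t. has_dist_time_derivative (\<lambda>s. dist_of (\<lambda>x. q x s)) q\<^sub>t t \<and>
          (\<forall>\<phi>. test_function \<phi> \<longrightarrow>
             t * q\<^sub>t \<phi> =
               - K * dist_deriv (dist_of (\<lambda>x. x * q x t)) \<phi>
               + H / 4 * t powr (4*K + 2*H) * (dist_deriv ^^ 4) (dist_of (\<lambda>x. q x t)) \<phi>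
               + H * t powr (2*K + H) / sqrt (2 * pi) * (dist_deriv ^^ 2) dirac_delta \<phi>)"
    by blast
qed

text \<open>All laws live on one probability space as scalings of \<open>mix_var\<close>. A positive
  exponent makes the scale tend to 0, so the scaled variables tend to 0 pointwise and bounded
  continuous test integrals converge by dominated convergence.\<close>

lemma initial_dirac_q:
  assumes pos: "0 < K + H/2"
  shows "initial_dirac q"
  unfolding initial_dirac_def
proof (intro allI impI)
  fix \<tau> :: "nat \<Rightarrow> real" assume \<tau>: "filterlim \<tau> (at_right 0) sequentially"
  interpret P: prob_space std_normal_pair by (rule prob_space_std_normal_pair)
  let ?\<mu> = "\<lambda>n. density lborel (\<lambda>x. ennreal (q x (\<tau> n)))"
  from \<tau> have lim: "\<tau> \<longlonglongrightarrow> 0" and "eventually (\<lambda>n. 0 < \<tau> n) sequentially"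
    by (auto simp: filterlim_at elim!: eventually_mono)
  \<comment> \<open>Early terms of \<tau> may be nonpositive, and there \<open>q\<close> is
    unconstrained. The sequence is shifted past them, which does not affect the limit.\<close>
  then obtain n0 where n0: "\<And>n. 0 < \<tau> (n + n0)"
    unfolding eventually_sequentially by (meson le_add2)
  have "weak_conv_m (\<lambda>n. ?\<mu> (n + n0)) (return borel 0)"
  proof (rule integral_bdd_continuous_conv_imp_weak_conv)
    show "real_distribution (?\<mu> (n + n0))" for n
      unfolding density_eq_distr_mix_var[OF n0] by (rule P.real_distribution_distr) simp
    show "real_distribution (return borel (0::real))"
      by (intro real_distribution.intro prob_space_return real_distribution_axioms.intro) auto
    fix f :: "real \<Rightarrow> real" assume f: "\<And>x. isCont f x" and bf: "\<And>x. \<bar>f x\<bar> \<le> 1"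
    have [measurable]: "f \<in> borel_measurable borel"
      using f by (auto intro!: borel_measurable_continuous_onI continuous_at_imp_continuous_on)
    have "(\<lambda>n. \<integral>p. f (\<tau> (n + n0) powr (K + H/2) * mix_var p) \<partial>std_normal_pair)
        \<longlonglongrightarrow> (\<integral>p. f 0 \<partial>std_normal_pair)"
    proof (rule integral_dominated_convergence[where w="\<lambda>_. 1"])
      have "(\<lambda>n. \<tau> (n + n0) powr (K + H/2)) \<longlonglongrightarrow> 0 powr (K + H/2)"
        using pos n0 by (intro tendsto_powr' LIMSEQ_ignore_initial_segment[OF lim] tendsto_const)
          (auto intro!: always_eventually less_imp_le)
      then have "(\<lambda>n. \<tau> (n + n0) powr (K + H/2) * mix_var p) \<longlonglongrightarrow> 0" for p
        by (intro tendsto_mult_left_zero) simp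
      then show "AE p in std_normal_pair. (\<lambda>n. f (\<tau> (n + n0) powr (K + H/2) * mix_var p)) \<longlonglongrightarrow> f 0"
        by (intro AE_I2 isCont_tendsto_compose[OF f])
    qed (auto simp: bf)
    then show "(\<lambda>n. integral\<^sup>L (?\<mu> (n + n0)) f) \<longlonglongrightarrow> integral\<^sup>L (return borel 0) f"
      unfolding density_eq_distr_mix_var[OF n0]
      by (simp add: integral_distr integral_return P.prob_space)
  qed
  then show "weak_conv_m ?\<mu> (return borel 0)"
    unfolding weak_conv_m_def weak_conv_def by (auto intro: LIMSEQ_offset)
qed

end

end

theorem theorem2p2:
  fixes M :: "'a measure" and B1 B2 :: "real \<Rightarrow> 'a \<Rightarrow> real" and K H :: real
  assumes "K > 0" and "0 < H" and "H < 1"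
    and "prob_space M"
    and "standard_brownian_motion M B1"
    and "fractional_brownian_motion M H B2"
    and "independent_processes M B1 B2"
  shows "(\<forall>t>0. has_density M (L_F K B1 B2 t) (\<lambda>x. LF_density K H x t)) \<and>
    (\<forall>q. (\<forall>t>0. has_density M (L_F K B1 B2 t) (\<lambda>x. q x t)) \<longrightarrow>
       solves_LF_equation K H q \<and> initial_dirac q)"
proof -
  interpret subordinated_motion M B1 B2 K H
    using assms by (simp add: subordinated_motion_def subordinated_motion_axioms_def)
  show ?thesis
    using LF_density_has_density solves_LF_equation_q initial_dirac_q assms(1,2) by auto
qed

end
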